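(* Let $V$ be a finite-dimensional complex representation of a complex reductive group $G$ with $\mathbb{C}(V)^G=\operatorname{Frac}(\mathbb{C}[V]^G)$. Suppose $\mathbb{C}[V]^G$ is a unique factorization domain and let $(Y,W)$ have the Galois restriction property. If $Y$ intersects every closed $G$-orbit in $V$, then $Y$ (with the group $W$) has the Chevalley restriction property.
   Context: Subvarieties are irreducible. Galois restriction property: for $Y\subset V$ a closed subvariety and $W$ a finite group acting faithfully on $Y$ by birational automorphisms, $(Y,W)$ has this property if restriction of functions gives an isomorphism $\mathbb{C}(V)^G\to\mathbb{C}(Y)^W$. Chevalley restriction property: for $Y\subset V$ a closed subvariety and $W$ a finite group acting faithfully on $Y$ by regular automorphisms, $(Y,W)$ has this property if restriction of functions is an isomorphism $\mathbb{C}[V]^G\to\mathbb{C}[Y]^W$.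
   Formalization: The W-action on Y need not be regular, so the Chevalley property is claimed when W acts faithfully by regular automorphisms; in general, restriction is shown to be an isomorphism from C[V]^G to the regular functions on Y that are W-invariant as rational functions. *)

theory Defs
  imports "HOL-Analysis.Analysis" "HOL-Algebra.QuotRing" "HOL-Algebra.Ring_Divisibility"
begin

(* A complex vector space is given by its scalar multiplication s on a whole type 'v; every notion
   of algebraic geometry on it is then parametrised by s. *)

section \<open>Affine varieties in a complex vector space\<close>

(* The polynomial functions on the space: generated as an algebra by the linear functionals. *)
inductive_set poly_functions ::
    "(complex \<Rightarrow> 'v \<Rightarrow> 'v) \<Rightarrow> ('v::ab_group_add \<Rightarrow> complex) set"
  for s :: "complex \<Rightarrow> 'v \<Rightarrow> 'v"
  where
    linear: "Vector_Spaces.linear s (*) l \<Longrightarrow> l \<in> poly_functions s"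
  | const: "(\<lambda>_. c) \<in> poly_functions s"
  | add: "p \<in> poly_functions s \<Longrightarrow> q \<in> poly_functions s \<Longrightarrow> (\<lambda>x. p x + q x) \<in> poly_functions s"
  | mult: "p \<in> poly_functions s \<Longrightarrow> q \<in> poly_functions s \<Longrightarrow> (\<lambda>x. p x * q x) \<in> poly_functions s"

definition zariski :: "(complex \<Rightarrow> 'v \<Rightarrow> 'v) \<Rightarrow> 'v::ab_group_add topology" where
  "zariski s = topology_generated_by {{x. p x \<noteq> 0} | p. p \<in> poly_functions s}"

definition irreduciblein :: "'a topology \<Rightarrow> 'a set \<Rightarrow> bool" where
  "irreduciblein X Y \<longleftrightarrow> Y \<subseteq> topspace X \<and> Y \<noteq> {} \<and>
     (\<forall>A B. closedin X A \<and> closedin X B \<and> Y \<subseteq> A \<union> B \<longrightarrow> Y \<subseteq> A \<or> Y \<subseteq> B)"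

definition closed_subvariety :: "(complex \<Rightarrow> 'v \<Rightarrow> 'v) \<Rightarrow> 'v::ab_group_add set \<Rightarrow> bool" where
  "closed_subvariety s Y \<longleftrightarrow> closedin (zariski s) Y \<and> irreduciblein (zariski s) Y"

(* The ring of regular functions on Y; for Y = UNIV it is the ring of polynomial functions. *)
definition coordinate_ring ::
    "(complex \<Rightarrow> 'v \<Rightarrow> 'v) \<Rightarrow> 'v::ab_group_add set \<Rightarrow> ('v \<Rightarrow> complex) ring" where
  "coordinate_ring s Y =
    \<lparr>carrier = {restrict p Y | p. p \<in> poly_functions s},
     monoid.mult = (\<lambda>f g. \<lambda>y\<in>Y. f y * g y), one = (\<lambda>y\<in>Y. 1),
     zero = (\<lambda>y\<in>Y. 0), add = (\<lambda>f g. \<lambda>y\<in>Y. f y + g y)\<rparr>"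

section \<open>Rational functions and rational maps\<close>

(* Validity on a nonempty, hence dense, open subset of the irreducible set Y. *)
definition generically ::
    "(complex \<Rightarrow> 'v \<Rightarrow> 'v) \<Rightarrow> 'v::ab_group_add set \<Rightarrow> ('v \<Rightarrow> bool) \<Rightarrow> bool" where
  "generically s Y P \<longleftrightarrow>
     (\<exists>U. openin (subtopology (zariski s) Y) U \<and> U \<noteq> {} \<and> (\<forall>y\<in>U. P y))"

definition germ ::
    "(complex \<Rightarrow> 'v \<Rightarrow> 'v) \<Rightarrow> 'v::ab_group_add set \<Rightarrow> ('v \<Rightarrow> complex) \<Rightarrow> ('v \<Rightarrow> complex) set" where
  "germ s Y f = {g. generically s Y (\<lambda>y. g y = f y)}"

(* The field of rational functions on Y. A rational function is the class, modulo generic equality,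
   of a quotient of polynomial functions whose denominator does not vanish identically on Y. The
   operations are those of representatives: as in the library's quotient rings, the unions below
   range over equal sets. *)
definition function_field ::
    "(complex \<Rightarrow> 'v \<Rightarrow> 'v) \<Rightarrow> 'v::ab_group_add set \<Rightarrow> ('v \<Rightarrow> complex) set ring" where
  "function_field s Y =
    \<lparr>carrier = {germ s Y (\<lambda>y. a y / b y) | a b.
       a \<in> poly_functions s \<and> b \<in> poly_functions s \<and> (\<exists>y\<in>Y. b y \<noteq> 0)},
     monoid.mult = (\<lambda>F H. \<Union>f\<in>F. \<Union>h\<in>H. germ s Y (\<lambda>y. f y * h y)), one = germ s Y (\<lambda>_. 1),
     zero = germ s Y (\<lambda>_. 0), add = (\<lambda>F H. \<Union>f\<in>F. \<Union>h\<in>H. germ s Y (\<lambda>y. f y + h y))\<rparr>"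

(* Rational maps from Y to Y are represented by total functions; only their values at general
   points of Y matter. *)
definition rational_map ::
    "(complex \<Rightarrow> 'v \<Rightarrow> 'v) \<Rightarrow> 'v::ab_group_add set \<Rightarrow> ('v \<Rightarrow> 'v) \<Rightarrow> bool" where
  "rational_map s Y \<phi> \<longleftrightarrow> generically s Y (\<lambda>y. \<phi> y \<in> Y) \<and>
     (\<forall>p\<in>poly_functions s. germ s Y (p \<circ> \<phi>) \<in> carrier (function_field s Y))"

definition dominant ::
    "(complex \<Rightarrow> 'v \<Rightarrow> 'v) \<Rightarrow> 'v::ab_group_add set \<Rightarrow> ('v \<Rightarrow> 'v) \<Rightarrow> bool" where
  "dominant s Y \<phi> \<longleftrightarrow>
     (\<forall>p\<in>poly_functions s. generically s Y (\<lambda>y. p (\<phi> y) = 0) \<longrightarrow> (\<forall>y\<in>Y. p y = 0))"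

definition birational_automorphism ::
    "(complex \<Rightarrow> 'v \<Rightarrow> 'v) \<Rightarrow> 'v::ab_group_add set \<Rightarrow> ('v \<Rightarrow> 'v) \<Rightarrow> bool" where
  "birational_automorphism s Y \<phi> \<longleftrightarrow> rational_map s Y \<phi> \<and> dominant s Y \<phi> \<and>
     (\<exists>\<psi>. rational_map s Y \<psi> \<and> dominant s Y \<psi> \<and>
       generically s Y (\<lambda>y. \<phi> (\<psi> y) = y) \<and> generically s Y (\<lambda>y. \<psi> (\<phi> y) = y))"

definition pullback ::
    "(complex \<Rightarrow> 'v \<Rightarrow> 'v) \<Rightarrow> 'v::ab_group_add set \<Rightarrow> ('v \<Rightarrow> 'v) \<Rightarrow>
     ('v \<Rightarrow> complex) set \<Rightarrow> ('v \<Rightarrow> complex) set" where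
  "pullback s Y \<phi> F = (\<Union>f\<in>F. germ s Y (f \<circ> \<phi>))"

definition regular_map ::
    "(complex \<Rightarrow> 'v \<Rightarrow> 'v) \<Rightarrow> 'v::ab_group_add set \<Rightarrow> ('v \<Rightarrow> 'v) \<Rightarrow> bool" where
  "regular_map s Y \<phi> \<longleftrightarrow> (\<forall>y\<in>Y. \<phi> y \<in> Y) \<and>
     (\<forall>p\<in>poly_functions s. restrict (p \<circ> \<phi>) Y \<in> carrier (coordinate_ring s Y))"

definition regular_automorphism ::
    "(complex \<Rightarrow> 'v \<Rightarrow> 'v) \<Rightarrow> 'v::ab_group_add set \<Rightarrow> ('v \<Rightarrow> 'v) \<Rightarrow> bool" where
  "regular_automorphism s Y \<phi> \<longleftrightarrow> regular_map s Y \<phi> \<and>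
     (\<exists>\<psi>. regular_map s Y \<psi> \<and> (\<forall>y\<in>Y. \<phi> (\<psi> y) = y \<and> \<psi> (\<phi> y) = y))"

section \<open>Invariants\<close>

(* The operators a g, for g in K, are the regular, respectively birational, automorphisms by which
   a group with underlying set K acts on Y. *)

definition regular_invariants ::
    "(complex \<Rightarrow> 'v \<Rightarrow> 'v) \<Rightarrow> 'v::ab_group_add set \<Rightarrow> 'k set \<Rightarrow> ('k \<Rightarrow> 'v \<Rightarrow> 'v) \<Rightarrow>
     ('v \<Rightarrow> complex) ring" where
  "regular_invariants s Y K a = (coordinate_ring s Y)
     \<lparr>carrier := {f \<in> carrier (coordinate_ring s Y). \<forall>g\<in>K. \<forall>y\<in>Y. f (a g y) = f y}\<rparr>"

definition rational_invariants ::
    "(complex \<Rightarrow> 'v \<Rightarrow> 'v) \<Rightarrow> 'v::ab_group_add set \<Rightarrow> 'k set \<Rightarrow> ('k \<Rightarrow> 'v \<Rightarrow> 'v) \<Rightarrow>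
     ('v \<Rightarrow> complex) set ring" where
  "rational_invariants s Y K a = (function_field s Y)
     \<lparr>carrier := {F \<in> carrier (function_field s Y). \<forall>g\<in>K. pullback s Y (a g) F = F}\<rparr>"

(* The regular functions on Y that are invariant as rational functions: this is the meaning of
   invariant regular function when K acts only by birational automorphisms. *)
definition regular_rational_invariants ::
    "(complex \<Rightarrow> 'v \<Rightarrow> 'v) \<Rightarrow> 'v::ab_group_add set \<Rightarrow> 'k set \<Rightarrow> ('k \<Rightarrow> 'v \<Rightarrow> 'v) \<Rightarrow>
     ('v \<Rightarrow> complex) ring" where
  "regular_rational_invariants s Y K a = (coordinate_ring s Y)
     \<lparr>carrier := {f \<in> carrier (coordinate_ring s Y).
        germ s Y f \<in> carrier (rational_invariants s Y K a)}\<rparr>"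

(* The set of rational functions on the whole space that are quotients of invariant polynomials. *)
definition invariant_fractions ::
    "(complex \<Rightarrow> 'v \<Rightarrow> 'v) \<Rightarrow> 'k set \<Rightarrow> ('k \<Rightarrow> 'v \<Rightarrow> 'v) \<Rightarrow> ('v::ab_group_add \<Rightarrow> complex) set set" where
  "invariant_fractions s K a = {germ s UNIV (\<lambda>x. p x / q x) | p q.
     p \<in> carrier (regular_invariants s UNIV K a) \<and>
     q \<in> carrier (regular_invariants s UNIV K a) \<and> (\<exists>x. q x \<noteq> 0)}"

section \<open>Reductive groups and their representations\<close>

definition GL :: "(complex^'n^'n) monoid" where
  "GL = \<lparr>carrier = {A. invertible A}, monoid.mult = (**), one = mat 1\<rparr>"

definition matrix_scale :: "complex \<Rightarrow> complex^'n^'n \<Rightarrow> complex^'n^'n" where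
  "matrix_scale c A = (\<chi> i j. c * A $ i $ j)"

definition zariski_GL :: "(complex^'n^'n) topology" where
  "zariski_GL = subtopology (zariski matrix_scale) (carrier GL)"

definition linear_algebraic_group :: "(complex^'n^'n) set \<Rightarrow> bool" where
  "linear_algebraic_group G \<longleftrightarrow> subgroup G GL \<and> closedin zariski_GL G"

definition unipotent :: "complex^'n^'n \<Rightarrow> bool" where
  "unipotent A \<longleftrightarrow> (\<exists>k::nat. (((**) (A - mat 1)) ^^ k) (mat 1) = 0)"

(* Triviality of the unipotent radical, the largest connected unipotent closed normal subgroup.
   The group itself need not be connected. *)
definition reductive_group :: "(complex^'n^'n) set \<Rightarrow> bool" where
  "reductive_group G \<longleftrightarrow> linear_algebraic_group G \<and>
     (\<forall>N. N \<lhd> (GL\<lparr>carrier := G\<rparr>) \<and> closedin zariski_GL N \<and> connectedin zariski_GL N \<and>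
          (\<forall>A\<in>N. unipotent A) \<longrightarrow> N = {mat 1})"

(* The matrix coefficients are required to be regular functions on G, that is, restrictions of
   elements of the ring generated by the matrix entries and the inverse of the determinant. *)
definition rational_representation ::
    "(complex^'n^'n) set \<Rightarrow> (complex \<Rightarrow> 'v \<Rightarrow> 'v) \<Rightarrow> (complex^'n^'n \<Rightarrow> 'v \<Rightarrow> 'v::ab_group_add) \<Rightarrow> bool"
  where
  "rational_representation G s \<rho> \<longleftrightarrow>
     (\<forall>A\<in>G. Vector_Spaces.linear s s (\<rho> A)) \<and>
     (\<forall>v. \<rho> (mat 1) v = v) \<and>
     (\<forall>A\<in>G. \<forall>B\<in>G. \<forall>v. \<rho> (A ** B) v = \<rho> A (\<rho> B v)) \<and>
     (\<forall>v l. Vector_Spaces.linear s (*) l \<longrightarrow>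
       (\<exists>p\<in>poly_functions matrix_scale. \<exists>k::nat. \<forall>A\<in>G. l (\<rho> A v) = p A / det A ^ k))"

definition orbit_of :: "'k set \<Rightarrow> ('k \<Rightarrow> 'v \<Rightarrow> 'v) \<Rightarrow> 'v \<Rightarrow> 'v set" where
  "orbit_of K a v = (\<lambda>g. a g v) ` K"

section \<open>The restriction properties\<close>

definition faithful_birational_action ::
    "(complex \<Rightarrow> 'v \<Rightarrow> 'v) \<Rightarrow> 'v::ab_group_add set \<Rightarrow> ('w, 'm) monoid_scheme \<Rightarrow> ('w \<Rightarrow> 'v \<Rightarrow> 'v) \<Rightarrow> bool"
  where
  "faithful_birational_action s Y W \<alpha> \<longleftrightarrow>
     (\<forall>w\<in>carrier W. birational_automorphism s Y (\<alpha> w)) \<and>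
     (\<forall>w\<in>carrier W. \<forall>w'\<in>carrier W. generically s Y (\<lambda>y. \<alpha> (w \<otimes>\<^bsub>W\<^esub> w') y = \<alpha> w (\<alpha> w' y))) \<and>
     (\<forall>w\<in>carrier W. generically s Y (\<lambda>y. \<alpha> w y = y) \<longleftrightarrow> w = \<one>\<^bsub>W\<^esub>)"

definition faithful_regular_action ::
    "(complex \<Rightarrow> 'v \<Rightarrow> 'v) \<Rightarrow> 'v::ab_group_add set \<Rightarrow> ('w, 'm) monoid_scheme \<Rightarrow> ('w \<Rightarrow> 'v \<Rightarrow> 'v) \<Rightarrow> bool"
  where
  "faithful_regular_action s Y W \<alpha> \<longleftrightarrow>
     (\<forall>w\<in>carrier W. regular_automorphism s Y (\<alpha> w)) \<and>
     (\<forall>w\<in>carrier W. \<forall>w'\<in>carrier W. \<forall>y\<in>Y. \<alpha> (w \<otimes>\<^bsub>W\<^esub> w') y = \<alpha> w (\<alpha> w' y)) \<and>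
     (\<forall>w\<in>carrier W. (\<forall>y\<in>Y. \<alpha> w y = y) \<longleftrightarrow> w = \<one>\<^bsub>W\<^esub>)"

(* A rational function F on the whole space can be restricted to Y if it is a quotient whose
   denominator does not vanish identically on Y. *)
definition restrictable ::
    "(complex \<Rightarrow> 'v \<Rightarrow> 'v) \<Rightarrow> 'v::ab_group_add set \<Rightarrow> ('v \<Rightarrow> complex) set \<Rightarrow> bool" where
  "restrictable s Y F \<longleftrightarrow> (\<exists>a\<in>poly_functions s. \<exists>b\<in>poly_functions s.
     (\<exists>y\<in>Y. b y \<noteq> 0) \<and> (\<lambda>x. a x / b x) \<in> F)"

(* The union ranges over equal sets if F is restrictable, and is empty otherwise. *)
definition rational_restriction ::
    "(complex \<Rightarrow> 'v \<Rightarrow> 'v) \<Rightarrow> 'v::ab_group_add set \<Rightarrow> ('v \<Rightarrow> complex) set \<Rightarrow> ('v \<Rightarrow> complex) set" where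
  "rational_restriction s Y F = \<Union>{germ s Y (\<lambda>x. a x / b x) | a b.
     a \<in> poly_functions s \<and> b \<in> poly_functions s \<and> (\<exists>y\<in>Y. b y \<noteq> 0) \<and> (\<lambda>x. a x / b x) \<in> F}"

definition galois_restriction_property ::
    "(complex \<Rightarrow> 'v \<Rightarrow> 'v) \<Rightarrow> 'k set \<Rightarrow> ('k \<Rightarrow> 'v \<Rightarrow> 'v) \<Rightarrow>
     'v::ab_group_add set \<Rightarrow> ('w, 'm) monoid_scheme \<Rightarrow> ('w \<Rightarrow> 'v \<Rightarrow> 'v) \<Rightarrow> bool" where
  "galois_restriction_property s G \<rho> Y W \<alpha> \<longleftrightarrow>
     closed_subvariety s Y \<and> group W \<and> finite (carrier W) \<and> faithful_birational_action s Y W \<alpha> \<and>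
     (\<forall>F\<in>carrier (rational_invariants s UNIV G \<rho>). restrictable s Y F) \<and>
     rational_restriction s Y \<in>
       ring_iso (rational_invariants s UNIV G \<rho>) (rational_invariants s Y (carrier W) \<alpha>)"

definition chevalley_restriction_property ::
    "(complex \<Rightarrow> 'v \<Rightarrow> 'v) \<Rightarrow> 'k set \<Rightarrow> ('k \<Rightarrow> 'v \<Rightarrow> 'v) \<Rightarrow>
     'v::ab_group_add set \<Rightarrow> ('w, 'm) monoid_scheme \<Rightarrow> ('w \<Rightarrow> 'v \<Rightarrow> 'v) \<Rightarrow> bool" where
  "chevalley_restriction_property s G \<rho> Y W \<alpha> \<longleftrightarrow>
     closed_subvariety s Y \<and> group W \<and> finite (carrier W) \<and> faithful_regular_action s Y W \<alpha> \<and>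
     (\<lambda>f. restrict f Y) \<in>
       ring_iso (regular_invariants s UNIV G \<rho>) (regular_invariants s Y (carrier W) \<alpha>)"

end

theory Submission
  imports Defs "HOL-Library.Function_Algebras" "HOL-Computational_Algebra.Fundamental_Theorem_Algebra"
begin

text \<open>Given a regular \<open>h\<close> on \<open>Y\<close> that is invariant as a rational function, the Galois property
  provides invariants \<open>p\<close>, \<open>q\<close> with \<open>p = h q\<close> on \<open>Y\<close>. If \<open>q v = 0\<close>, a closed orbit on which every
  invariant takes its value at \<open>v\<close> meets \<open>Y\<close>, so \<open>p v = 0\<close>. By the Nullstellensatz \<open>q\<close> divides a power
  of \<open>p\<close>, so each prime factor of \<open>q\<close> divides \<open>p\<close> and can be cancelled; hence \<open>q\<close> divides \<open>p\<close>.

  Closed orbits exist for every linear algebraic group: take the zeros of a maximal \<open>G\<close>-stable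
  proper ideal. All orbits in this set have the same vanishing ideal. Two such orbits meet,
  because the tensor product of the two function algebras over the coordinate ring of the zero set
  is nonzero, as one sees over a fraction field; so there is only one orbit.\<close>

section \<open>Nullstellensatz for countably generated algebras of functions\<close>

text \<open>Closed orbits are usually found by dimension theory: an orbit is open in its closure,
  and one of minimal dimension is closed. Here constructible sets and dimension give way to one
  algebraic fact: two regular maps on \<open>G\<close> whose images satisfy the same polynomial
  equations have a common value. This fact and the divisibility argument both rest on a
  Nullstellensatz, once for functions on pairs of matrices and once for polynomials with an inverse
  adjoined. It is therefore proved for any algebra of complex-valued functions with countably many
  generators. Such an algebra has countable dimension while the complex numbers are uncountable, and
  this forces the residue fields to be the complex numbers, without Noether normalisation or finite
  generation of ideals. Functions are taken on a whole type. Equations that cut out a subset, such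
  as \<open>G\<close> among the matrices, are put into the ideal to which the Nullstellensatz is
  applied, not into the algebra.\<close>

inductive_set fun_algebra :: "('x \<Rightarrow> complex) set \<Rightarrow> ('x \<Rightarrow> complex) set"
  for E :: "('x \<Rightarrow> complex) set"
  where
    gen: "f \<in> E \<Longrightarrow> f \<in> fun_algebra E"
  | const: "(\<lambda>_. c) \<in> fun_algebra E"
  | add: "f \<in> fun_algebra E \<Longrightarrow> g \<in> fun_algebra E \<Longrightarrow> f + g \<in> fun_algebra E"
  | mult: "f \<in> fun_algebra E \<Longrightarrow> g \<in> fun_algebra E \<Longrightarrow> f * g \<in> fun_algebra E"

lemma fun_algebra_0: "0 \<in> fun_algebra E" and fun_algebra_1: "1 \<in> fun_algebra E"
  using fun_algebra.const[of 0 E] fun_algebra.const[of 1 E]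
  by (simp_all add: zero_fun_def one_fun_def)

lemma fun_algebra_diff:
  assumes "f \<in> fun_algebra E" "g \<in> fun_algebra E"
  shows "f - g \<in> fun_algebra E"
proof -
  have "f + (\<lambda>_. -1) * g \<in> fun_algebra E"
    by (intro fun_algebra.intros assms)
  moreover have "f + (\<lambda>_. -1) * g = f - g" by (auto simp: fun_eq_iff)
  ultimately show ?thesis by simp
qed

lemma fun_algebra_sum:
  assumes "\<And>i. i \<in> A \<Longrightarrow> f i \<in> fun_algebra E"
  shows "(\<Sum>i\<in>A. f i) \<in> fun_algebra E"
  using assms by (induction A rule: infinite_finite_induct) (auto intro: fun_algebra_0 fun_algebra.add)

lemma fun_algebra_prod:
  assumes "\<And>i. i \<in> A \<Longrightarrow> f i \<in> fun_algebra E"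
  shows "(\<Prod>i\<in>A. f i) \<in> fun_algebra E"
  using assms by (induction A rule: infinite_finite_induct) (auto intro: fun_algebra_1 fun_algebra.mult)

lemma fun_algebra_power: "f \<in> fun_algebra E \<Longrightarrow> f ^ n \<in> fun_algebra E"
  by (induction n) (auto intro: fun_algebra_1 fun_algebra.mult)

lemma sum_fun_apply: "(\<Sum>i\<in>A. f i) x = (\<Sum>i\<in>A. f i x)"
  for f :: "'i \<Rightarrow> 'x \<Rightarrow> 'b::comm_monoid_add"
  by (induction A rule: infinite_finite_induct) auto

lemma prod_fun_apply: "(\<Prod>i\<in>A. f i) x = (\<Prod>i\<in>A. f i x)"
  for f :: "'i \<Rightarrow> 'x \<Rightarrow> 'b::comm_monoid_mult"
  by (induction A rule: infinite_finite_induct) auto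

lemma power_fun_apply: "(f ^ n) x = f x ^ n"
  for f :: "'x \<Rightarrow> 'b::monoid_mult"
  by (induction n) auto

text \<open>Scaling is multiplication by a constant function, so linear combinations are visibly
  members of the algebra and of its ideals.\<close>

interpretation fn: vector_space "\<lambda>(c::complex) (f::'x \<Rightarrow> complex). (\<lambda>_. c) * f"
  by unfold_locales (auto simp: fun_eq_iff algebra_simps)

text \<open>Monomials in the generators span, and a countable set has only countably many finite
  words.\<close>

lemma fun_algebra_countably_spanned:
  assumes "countable E"
  obtains M where "countable M" "fun_algebra E \<subseteq> fn.span M"
proof
  let ?M = "prod_list ` lists E"
  show "countable ?M" using assms by simp
  have mono_mult: "f * g \<in> fn.span ?M" if "f \<in> fn.span ?M" and g: "g \<in> ?M" for f g
    using that(1)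
  proof (induction rule: fn.span_induct_alt)
    case base show ?case unfolding mult_zero_left mult_zero_right by (rule fn.span_zero)
  next
    case (step c m f)
    obtain xs ys where "m = prod_list xs" "g = prod_list ys" "xs \<in> lists E" "ys \<in> lists E"
      using step(1) g by auto
    then have "m * g \<in> ?M" by (intro image_eqI[of _ _ "xs @ ys"]) auto
    then have "(\<lambda>_. c) * (m * g) + f * g \<in> fn.span ?M"
      by (intro fn.span_add[OF fn.span_scale[OF fn.span_base] step(2)])
    then show ?case by (simp only: distrib_right mult.assoc)
  qed
  have span_mult: "f * g \<in> fn.span ?M" if f: "f \<in> fn.span ?M" and "g \<in> fn.span ?M" for f g
    using that(2)
  proof (induction rule: fn.span_induct_alt)
    case base show ?case unfolding mult_zero_left mult_zero_right by (rule fn.span_zero)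
  next
    case (step c m g)
    have "(\<lambda>_. c) * (f * m) + f * g \<in> fn.span ?M"
      by (intro fn.span_add fn.span_scale mono_mult f step)
    then show ?case by (simp only: distrib_left mult.left_commute)
  qed
  show "fun_algebra E \<subseteq> fn.span ?M"
  proof
    fix f assume "f \<in> fun_algebra E"
    then show "f \<in> fn.span ?M"
    proof induction
      case (gen f)
      then have "f \<in> ?M" by (intro image_eqI[of _ _ "[f]"]) auto
      then show ?case by (rule fn.span_base)
    next
      case (const c)
      have "(\<lambda>_. c) * 1 \<in> fn.span ?M"
        by (intro fn.span_scale fn.span_base image_eqI[of _ _ "[]"]) auto
      then show ?case by (simp only: mult_1_right)
    next
      case (add f g)
      then show ?case by (intro fn.span_add)
    next
      case (mult f g)
      then show ?case by (intro span_mult)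
    qed
  qed
qed

section \<open>Ideals and characters of function algebras\<close>

definition fun_ideal :: "('x \<Rightarrow> complex) set \<Rightarrow> ('x \<Rightarrow> complex) set \<Rightarrow> bool" where
  "fun_ideal A I \<longleftrightarrow> I \<subseteq> A \<and> 0 \<in> I \<and> (\<forall>f\<in>I. \<forall>g\<in>I. f + g \<in> I) \<and> (\<forall>f\<in>A. \<forall>g\<in>I. f * g \<in> I)"

lemma fun_idealD:
  assumes "fun_ideal A I"
  shows "f \<in> I \<Longrightarrow> f \<in> A" "0 \<in> I" "f \<in> I \<Longrightarrow> g \<in> I \<Longrightarrow> f + g \<in> I"
    "f \<in> A \<Longrightarrow> g \<in> I \<Longrightarrow> f * g \<in> I"
  using assms by (auto simp: fun_ideal_def)

lemma fun_ideal_diff: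
  assumes "fun_ideal (fun_algebra E) I" "f \<in> I" "g \<in> I"
  shows "f - g \<in> I"
proof -
  have "f + (\<lambda>_. -1) * g \<in> I"
    by (intro fun_idealD[OF assms(1)] assms fun_algebra.const)
  moreover have "f + (\<lambda>_. -1) * g = f - g" by (auto simp: fun_eq_iff)
  ultimately show ?thesis by simp
qed

lemma fun_ideal_sum:
  assumes "fun_ideal A I" "\<And>i. i \<in> K \<Longrightarrow> f i \<in> I"
  shows "(\<Sum>i\<in>K. f i) \<in> I"
  using assms(2) by (induction K rule: infinite_finite_induct) (auto intro: fun_idealD[OF assms(1)])

text \<open>These are the characters of \<open>A\<close>, the points of its spectrum; only the
  values on \<open>A\<close> carry information.\<close>

definition fun_hom :: "('x \<Rightarrow> complex) set \<Rightarrow> (('x \<Rightarrow> complex) \<Rightarrow> complex) \<Rightarrow> bool" where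
  "fun_hom A \<theta> \<longleftrightarrow> (\<forall>c. \<theta> (\<lambda>_. c) = c) \<and> (\<forall>f\<in>A. \<forall>g\<in>A. \<theta> (f + g) = \<theta> f + \<theta> g) \<and>
    (\<forall>f\<in>A. \<forall>g\<in>A. \<theta> (f * g) = \<theta> f * \<theta> g)"

lemma fun_homD:
  assumes "fun_hom A \<theta>"
  shows "\<theta> (\<lambda>_. c) = c" "f \<in> A \<Longrightarrow> g \<in> A \<Longrightarrow> \<theta> (f + g) = \<theta> f + \<theta> g"
    "f \<in> A \<Longrightarrow> g \<in> A \<Longrightarrow> \<theta> (f * g) = \<theta> f * \<theta> g"
  using assms by (auto simp: fun_hom_def)

lemma fun_hom_diff:
  assumes "fun_hom (fun_algebra E) \<theta>" "f \<in> fun_algebra E" "g \<in> fun_algebra E"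
  shows "\<theta> (f - g) = \<theta> f - \<theta> g"
  using fun_homD(2)[OF assms(1) fun_algebra_diff[OF assms(2,3)] assms(3)] by simp

lemma fun_hom_power:
  assumes "fun_hom (fun_algebra E) \<theta>" "f \<in> fun_algebra E"
  shows "\<theta> (f ^ n) = \<theta> f ^ n"
proof (induction n)
  case 0 show ?case using fun_homD(1)[OF assms(1), of 1] by (simp add: one_fun_def)
next
  case (Suc n)
  then show ?case
    using fun_homD(3)[OF assms fun_algebra_power[OF assms(2), of n]] by (simp only: power_Suc)
qed

text \<open>The predicate \<open>P\<close> serves two uses of Zorn's lemma: the trivial predicate
  gives maximal ideals for the Nullstellensatz, and stability under \<open>G\<close> gives maximal
  stable ideals, which need not be maximal ideals.\<close>

lemma maximal_fun_ideal_exists: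
  assumes "fun_ideal A I" "1 \<notin> I" "P I"
    and chain: "\<And>\<C>. subset.chain {J. fun_ideal A J \<and> P J} \<C> \<Longrightarrow> \<C> \<noteq> {} \<Longrightarrow> P (\<Union>\<C>)"
  obtains M where "fun_ideal A M" "1 \<notin> M" "P M" "I \<subseteq> M"
    "\<And>J. fun_ideal A J \<Longrightarrow> 1 \<notin> J \<Longrightarrow> P J \<Longrightarrow> M \<subseteq> J \<Longrightarrow> J = M"
proof -
  let ?\<A> = "{J. fun_ideal A J \<and> 1 \<notin> J \<and> P J \<and> I \<subseteq> J}"
  have "?\<A> \<noteq> {}" using assms by auto
  moreover have "\<Union>\<C> \<in> ?\<A>" if \<C>: "\<C> \<noteq> {}" "subset.chain ?\<A> \<C>" for \<C>
  proof -
    have sub: "\<C> \<subseteq> ?\<A>" and tot: "\<And>x y. x \<in> \<C> \<Longrightarrow> y \<in> \<C> \<Longrightarrow> x \<subseteq> y \<or> y \<subseteq> x"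
      using \<C> by (auto simp: subset_chain_def)
    have "fun_ideal A (\<Union>\<C>)"
      unfolding fun_ideal_def
    proof (intro conjI ballI)
      fix f g assume "f \<in> \<Union>\<C>" "g \<in> \<Union>\<C>"
      then obtain X where "X \<in> \<C>" "f \<in> X" "g \<in> X" using tot by blast
      moreover have "fun_ideal A X" using sub \<open>X \<in> \<C>\<close> by auto
      ultimately show "f + g \<in> \<Union>\<C>" by (auto dest: fun_idealD(3))
    next
      fix f g assume fg: "f \<in> A" "g \<in> \<Union>\<C>"
      then obtain X where "X \<in> \<C>" "g \<in> X" by auto
      moreover have "fun_ideal A X" using sub \<open>X \<in> \<C>\<close> by auto
      ultimately show "f * g \<in> \<Union>\<C>" using fg(1) by (auto dest: fun_idealD(4))
    qed (use sub \<C>(1) in \<open>auto simp: fun_ideal_def\<close>)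
    moreover have "P (\<Union>\<C>)"
      using sub tot \<C>(1) by (intro chain) (auto simp: subset_chain_def)
    ultimately show ?thesis using sub \<C>(1) by auto
  qed
  ultimately obtain M where "M \<in> ?\<A>" "\<forall>X\<in>?\<A>. M \<subseteq> X \<longrightarrow> X = M"
    using subset_Zorn_nonempty[of ?\<A>] by auto
  then show ?thesis by (intro that[of M]) auto
qed

text \<open>Otherwise the inverses of all the \<open>f - c\<close> modulo \<open>M\<close> would be uncountably many linearly
  independent elements of an algebra of countable dimension.\<close>
lemma maximal_fun_ideal_residue:
  assumes "countable E" and M: "fun_ideal (fun_algebra E) M" "1 \<notin> M"
    and max: "\<And>J. fun_ideal (fun_algebra E) J \<Longrightarrow> 1 \<notin> J \<Longrightarrow> M \<subseteq> J \<Longrightarrow> J = M"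
    and f: "f \<in> fun_algebra E"
  obtains c where "f - (\<lambda>_. c) \<in> M"
proof (rule ccontr)
  note MD = fun_idealD[OF M(1)]
  let ?A = "fun_algebra E"
  \<comment> \<open>The quotient by \<open>M\<close> is a field: the ideal generated by
    \<open>M\<close> and \<open>h\<close> is larger than \<open>M\<close>, hence contains 1.\<close>
  have inv: "\<exists>u\<in>?A. u * h - 1 \<in> M" if h: "h \<in> ?A" "h \<notin> M" for h
  proof -
    let ?J = "{u * h + m |u m. u \<in> ?A \<and> m \<in> M}"
    have JI: "u * h + m \<in> ?J" if "u \<in> ?A" "m \<in> M" for u m using that by blast
    have "fun_ideal ?A ?J"
      unfolding fun_ideal_def
    proof (intro conjI ballI)
      show "?J \<subseteq> ?A" using MD(1) h(1) by (auto intro!: fun_algebra.add fun_algebra.mult)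
      show "0 \<in> ?J" using JI[OF fun_algebra_0 MD(2)] by simp
    next
      fix a b assume "a \<in> ?J" "b \<in> ?J"
      then obtain u m v n where "a = u * h + m" "b = v * h + n" "u \<in> ?A" "v \<in> ?A" "m \<in> M" "n \<in> M"
        by auto
      then show "a + b \<in> ?J"
        by (intro CollectI exI[of _ "u + v"] exI[of _ "m + n"])
           (auto simp: algebra_simps intro: MD(3) fun_algebra.add)
    next
      fix a b assume "a \<in> ?A" "b \<in> ?J"
      then obtain u m where "b = u * h + m" "u \<in> ?A" "m \<in> M" by auto
      then show "a * b \<in> ?J" using \<open>a \<in> ?A\<close>
        by (intro CollectI exI[of _ "a * u"] exI[of _ "a * m"])
           (auto simp: algebra_simps intro: MD(4) fun_algebra.mult)
    qed
    moreover have "M \<subseteq> ?J" using JI[OF fun_algebra_0] by auto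
    moreover have "h \<in> ?J" using JI[OF fun_algebra_1 MD(2)] by simp
    ultimately have "1 \<in> ?J" using max[of ?J] h(2) by blast
    then obtain u m where um: "1 = u * h + m" "u \<in> ?A" "m \<in> M" by auto
    have "u * h - 1 = 0 - m" using um(1) by (simp add: algebra_simps)
    then show ?thesis using um(2) fun_ideal_diff[OF M(1) MD(2) um(3)] by metis
  qed
  have prime: "a \<in> M \<or> b \<in> M" if ab: "a * b \<in> M" "a \<in> ?A" "b \<in> ?A" for a b
  proof (rule ccontr)
    assume contra: "\<not> (a \<in> M \<or> b \<in> M)"
    then obtain u where u: "u \<in> ?A" "u * a - 1 \<in> M" using inv ab by blast
    have "u * (a * b) - b * (u * a - 1) \<in> M"
      by (rule fun_ideal_diff[OF M(1) MD(4) MD(4)]) (use u ab in auto)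
    moreover have "u * (a * b) - b * (u * a - 1) = b" by (simp add: algebra_simps)
    ultimately show False using contra by simp
  qed
  assume "\<not> thesis"
  then have notM: "f - (\<lambda>_. c) \<notin> M" for c using that by blast
  have fA: "f - (\<lambda>_. c) \<in> ?A" for c using f by (intro fun_algebra_diff fun_algebra.const)
  have "\<exists>u\<in>?A. u * (f - (\<lambda>_. c)) - 1 \<in> M" for c using inv notM fA by blast
  then obtain u where u: "\<And>c. u c \<in> ?A" "\<And>c. u c * (f - (\<lambda>_. c)) - 1 \<in> M" by metis
  have poly_mem: "(\<lambda>x. poly q (f x)) \<in> ?A" for q
  proof (induction q)
    case 0 show ?case using fun_algebra_0[of E] by (simp add: zero_fun_def)
  next
    case (pCons a q)
    have "(\<lambda>_. a) + f * (\<lambda>x. poly q (f x)) \<in> ?A"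
      using pCons f by (intro fun_algebra.add fun_algebra.const fun_algebra.mult)
    then show ?case by (simp add: plus_fun_def times_fun_def)
  qed
  \<comment> \<open>So \<open>f\<close> is transcendental modulo \<open>M\<close>: over the complex
    numbers a polynomial splits into linear factors, no \<open>f - r\<close> lies in
    \<open>M\<close>, and \<open>M\<close> is prime.\<close>
  have no_poly: "(\<lambda>x. poly q (f x)) \<notin> M" if "q \<noteq> 0" for q
    using that
  proof (induction "degree q" arbitrary: q)
    case 0
    then obtain c where c: "q = [:c:]" "c \<noteq> 0" by (metis degree_eq_zeroE pCons_0_0)
    show ?case
    proof
      assume "(\<lambda>x. poly q (f x)) \<in> M"
      then have "(\<lambda>_. inverse c) * (\<lambda>x. poly q (f x)) \<in> M"
        by (intro MD(4) fun_algebra.const)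
      moreover have "(\<lambda>_. inverse c) * (\<lambda>x. poly q (f x)) = 1"
        using c by (auto simp: fun_eq_iff)
      ultimately show False using M(2) by simp
    qed
  next
    case (Suc n)
    then have "\<not> constant (poly q)" by (simp add: constant_degree)
    then obtain r where "poly q r = 0" using fundamental_theorem_of_algebra by blast
    then obtain p where p: "q = [:-r, 1:] * p" by (metis poly_eq_0_iff_dvd dvdE)
    with Suc have "p \<noteq> 0" by auto
    moreover have "degree q = degree [:-r, 1:] + degree p"
      unfolding p using \<open>p \<noteq> 0\<close> by (intro degree_mult_eq) auto
    ultimately have "degree p = n" using Suc(2) by simp
    then have nM: "(\<lambda>x. poly p (f x)) \<notin> M" using Suc \<open>p \<noteq> 0\<close> by blast
    have "(\<lambda>x. poly q (f x)) = (f - (\<lambda>_. r)) * (\<lambda>x. poly p (f x))"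
      unfolding p by (auto simp: fun_eq_iff algebra_simps)
    then show ?case using prime nM notM fA poly_mem by metis
  qed
  \<comment> \<open>If \<open>f - c\<close> and \<open>f - d\<close> had the same inverse,
    subtracting the two relations would put \<open>(d - c) * u c\<close> into \<open>M\<close>,
    although \<open>u c\<close> is a unit modulo \<open>M\<close>.\<close>
  have inj: "inj u"
  proof
    fix c d assume eq: "u c = u d"
    show "c = d"
    proof (rule ccontr)
      assume "c \<noteq> d"
      let ?k = "(\<lambda>_. inverse (d - c)) :: 'a \<Rightarrow> complex"
      have "u c * (f - (\<lambda>_. c)) - 1 - (u d * (f - (\<lambda>_. d)) - 1) \<in> M"
        by (intro fun_ideal_diff[OF M(1)] u)
      also have "u c * (f - (\<lambda>_. c)) - 1 - (u d * (f - (\<lambda>_. d)) - 1) = (\<lambda>_. d - c) * u c"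
        using eq by (auto simp: fun_eq_iff algebra_simps)
      finally have "?k * (f - (\<lambda>_. c)) * ((\<lambda>_. d - c) * u c) \<in> M"
        by (rule MD(4)[OF fun_algebra.mult[OF fun_algebra.const fA]])
      also have "?k * (f - (\<lambda>_. c)) * ((\<lambda>_. d - c) * u c) = u c * (f - (\<lambda>_. c))"
        using \<open>c \<noteq> d\<close> by (auto simp: fun_eq_iff)
      finally have "u c * (f - (\<lambda>_. c)) - (u c * (f - (\<lambda>_. c)) - 1) \<in> M"
        by (rule fun_ideal_diff[OF M(1) _ u(2)])
      then show False using M(2) by simp
    qed
  qed
  obtain N where N: "countable N" "?A \<subseteq> fn.span N"
    using fun_algebra_countably_spanned[OF assms(1)] by blast
  have "\<exists>F. finite F \<and> F \<subseteq> N \<and> u c \<in> fn.span F" for c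
  proof -
    have "u c \<in> fn.span N" using u(1) N(2) by blast
    then obtain t r where "finite t" "t \<subseteq> N" "u c = (\<Sum>a\<in>t. (\<lambda>_. r a) * a)"
      unfolding fn.span_explicit by auto
    then show ?thesis by (intro exI[of _ t]) (auto intro: fn.span_sum fn.span_scale fn.span_base)
  qed
  \<comment> \<open>Pigeonhole: countably many finite-dimensional spans contain all the
    \<open>u c\<close>, so one of them contains \<open>u c\<close> for uncountably many
    \<open>c\<close>, and these are linearly dependent.\<close>
  then have "UNIV = (\<Union>F\<in>{F. finite F \<and> F \<subseteq> N}. {c. u c \<in> fn.span F})" by blast
  moreover have "countable {F. finite F \<and> F \<subseteq> N}" using N(1) by (rule countable_Collect_finite_subset)
  moreover have "uncountable (UNIV :: complex set)" by (rule uncountable_UNIV_complex)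
  ultimately obtain F where F: "finite F" "uncountable {c. u c \<in> fn.span F}"
    by (metis (mono_tags, lifting) countable_UN mem_Collect_eq)
  then have "infinite (u ` {c. u c \<in> fn.span F})"
    using inj by (metis countable_finite finite_imageD inj_on_subset subset_UNIV)
  then have "fn.dependent (u ` {c. u c \<in> fn.span F})"
    using fn.independent_span_bound[OF F(1)] by auto
  then obtain T w where T: "finite T" "T \<subseteq> u ` {c. u c \<in> fn.span F}"
      "(\<Sum>v\<in>T. (\<lambda>_. w v) * v) = 0" "\<exists>v\<in>T. w v \<noteq> 0"
    unfolding fn.dependent_explicit by blast
  obtain C where C: "T = u ` C" using T(2) by (metis subset_image_iff)
  have "finite C" using T(1) C inj by (metis finite_imageD inj_on_subset subset_UNIV)
  have dep: "(\<Sum>c\<in>C. (\<lambda>_. w (u c)) * u c) = 0"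
    using T(3) inj unfolding C by (subst (asm) sum.reindex) (auto intro: inj_on_subset)
  \<comment> \<open>The numerator of the partial fraction sum with coefficients
    \<open>w (u c)\<close> and poles \<open>c\<close>. At a pole with nonzero coefficient only one
    summand survives, so \<open>q\<close> is not zero.\<close>
  define q where "q = (\<Sum>c\<in>C. Polynomial.smult (w (u c)) (\<Prod>d\<in>C - {c}. [:- d, 1:]))"
  obtain c where c: "c \<in> C" "w (u c) \<noteq> 0" using T(4) C by auto
  have "poly q c = (\<Sum>e\<in>C. if e = c then w (u c) * (\<Prod>d\<in>C - {c}. c - d) else 0)"
    unfolding q_def poly_sum
  proof (rule sum.cong[OF refl])
    fix e assume "e \<in> C"
    then show "poly (Polynomial.smult (w (u e)) (\<Prod>d\<in>C - {e}. [:- d, 1:])) c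
      = (if e = c then w (u c) * (\<Prod>d\<in>C - {c}. c - d) else 0)"
      using c \<open>finite C\<close> by (auto simp: poly_prod)
  qed
  also have "\<dots> = w (u c) * (\<Prod>d\<in>C - {c}. c - d)" using c \<open>finite C\<close> by simp
  also have "\<dots> \<noteq> 0" using c \<open>finite C\<close> by auto
  finally have "q \<noteq> 0" by auto
  let ?P = "\<lambda>D. \<Prod>d\<in>D. (f - (\<lambda>_. d))"
  have "(\<lambda>x. poly q (f x)) = (\<Sum>c\<in>C. (\<lambda>_. w (u c)) * ?P (C - {c}))"
    unfolding q_def by (auto simp: fun_eq_iff poly_sum poly_prod sum_fun_apply prod_fun_apply)
  \<comment> \<open>Zero is subtracted in the form \<open>?P C\<close> times the dependence. As
    \<open>u c\<close> inverts \<open>f - c\<close> modulo \<open>M\<close>, each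
    \<open>?P C * u c\<close> is congruent to \<open>?P (C - {c})\<close>, so the difference lies in
    \<open>M\<close>.\<close>
  also have "\<dots> = (\<Sum>c\<in>C. (\<lambda>_. w (u c)) * ?P (C - {c})) - ?P C * (\<Sum>c\<in>C. (\<lambda>_. w (u c)) * u c)"
    unfolding dep by simp
  also have "\<dots> = (\<Sum>c\<in>C. (\<lambda>_. w (u c)) * ?P (C - {c}) - ?P C * ((\<lambda>_. w (u c)) * u c))"
    by (simp add: sum_distrib_left sum_subtractf)
  also have "\<dots> = (\<Sum>c\<in>C. (0 - (\<lambda>_. w (u c)) * ?P (C - {c})) * (u c * (f - (\<lambda>_. c)) - 1))"
    using \<open>finite C\<close>
    by (intro sum.cong refl) (simp add: prod.remove fun_eq_iff algebra_simps)
  also have "\<dots> \<in> M"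
    by (intro fun_ideal_sum[OF M(1)] u(2)
        MD(4)[OF fun_algebra_diff[OF fun_algebra_0 fun_algebra.mult[OF fun_algebra.const fun_algebra_prod[OF fA]]]])
  finally show False using no_poly \<open>q \<noteq> 0\<close> by blast
qed

text \<open>The character sends \<open>f\<close> to the only constant congruent to it modulo a
  maximal ideal above \<open>I\<close>; uniqueness makes it additive and multiplicative.\<close>

theorem fun_algebra_nullstellensatz:
  assumes "countable E" and I: "fun_ideal (fun_algebra E) I" "1 \<notin> I"
  obtains \<theta> where "fun_hom (fun_algebra E) \<theta>" "\<And>f. f \<in> I \<Longrightarrow> \<theta> f = 0"
proof -
  let ?A = "fun_algebra E"
  obtain M where M: "fun_ideal ?A M" "1 \<notin> M" "I \<subseteq> M"
      "\<And>J. fun_ideal ?A J \<Longrightarrow> 1 \<notin> J \<Longrightarrow> M \<subseteq> J \<Longrightarrow> J = M"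
    using maximal_fun_ideal_exists[OF I, of "\<lambda>_. True"] by auto
  note MD = fun_idealD[OF M(1)]
  have "\<forall>f\<in>?A. \<exists>c. f - (\<lambda>_. c) \<in> M"
    using maximal_fun_ideal_residue[OF assms(1) M(1,2,4)] by metis
  then obtain \<theta> where \<theta>: "\<And>f. f \<in> ?A \<Longrightarrow> f - (\<lambda>_. \<theta> f) \<in> M" by metis
  have uniq: "c = d" if "f - (\<lambda>_. c) \<in> M" "f - (\<lambda>_. d) \<in> M" for f c d
  proof (rule ccontr)
    assume "c \<noteq> d"
    have "(\<lambda>_. inverse (d - c)) * ((f - (\<lambda>_. c)) - (f - (\<lambda>_. d))) \<in> M"
      by (intro MD(4) fun_algebra.const fun_ideal_diff[OF M(1)] that)
    moreover have "(\<lambda>_. inverse (d - c)) * ((f - (\<lambda>_. c)) - (f - (\<lambda>_. d))) = 1"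
      using \<open>c \<noteq> d\<close> by (auto simp: fun_eq_iff)
    ultimately show False using M(2) by simp
  qed
  have "fun_hom ?A \<theta>"
    unfolding fun_hom_def
  proof (intro conjI allI ballI)
    fix c
    show "\<theta> (\<lambda>_. c) = c"
      using MD(2) by (intro uniq[OF \<theta>[OF fun_algebra.const]]) (simp add: fun_diff_def zero_fun_def)
  next
    fix f g assume fg: "f \<in> ?A" "g \<in> ?A"
    have "(f - (\<lambda>_. \<theta> f)) + (g - (\<lambda>_. \<theta> g)) \<in> M" by (intro MD(3) \<theta> fg)
    also have "(f - (\<lambda>_. \<theta> f)) + (g - (\<lambda>_. \<theta> g)) = f + g - (\<lambda>_. \<theta> f + \<theta> g)"
      by (auto simp: fun_eq_iff)
    finally show "\<theta> (f + g) = \<theta> f + \<theta> g" by (intro uniq[OF \<theta>[OF fun_algebra.add[OF fg]]])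
  next
    fix f g assume fg: "f \<in> ?A" "g \<in> ?A"
    have "f * (g - (\<lambda>_. \<theta> g)) + (\<lambda>_. \<theta> g) * (f - (\<lambda>_. \<theta> f)) \<in> M"
      by (intro MD(3,4) \<theta> fg fun_algebra.const)
    also have "f * (g - (\<lambda>_. \<theta> g)) + (\<lambda>_. \<theta> g) * (f - (\<lambda>_. \<theta> f)) = f * g - (\<lambda>_. \<theta> f * \<theta> g)"
      by (auto simp: fun_eq_iff algebra_simps)
    finally show "\<theta> (f * g) = \<theta> f * \<theta> g" by (intro uniq[OF \<theta>[OF fun_algebra.mult[OF fg]]])
  qed
  moreover have "\<theta> f = 0" if "f \<in> I" for f
  proof -
    have "f \<in> M" using that M(3) by auto
    moreover have "f - (\<lambda>_. 0) = f" by (auto simp: fun_eq_iff)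
    ultimately show ?thesis using uniq[OF \<theta>[of f], of 0] MD(1) by auto
  qed
  ultimately show ?thesis by (rule that)
qed

section \<open>Polynomial functions and the Zariski topology\<close>

lemma poly_functions_plus: "p \<in> poly_functions s \<Longrightarrow> q \<in> poly_functions s \<Longrightarrow> p + q \<in> poly_functions s"
  unfolding plus_fun_def by (rule poly_functions.add)

lemma poly_functions_times: "p \<in> poly_functions s \<Longrightarrow> q \<in> poly_functions s \<Longrightarrow> p * q \<in> poly_functions s"
  unfolding times_fun_def by (rule poly_functions.mult)

lemma poly_functions_diff:
  assumes "p \<in> poly_functions s" "q \<in> poly_functions s"
  shows "(\<lambda>x. p x - q x) \<in> poly_functions s"
  using poly_functions.add[OF assms(1) poly_functions.mult[OF poly_functions.const[of "-1"] assms(2)]]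
  by simp

lemma poly_functions_sum:
  "(\<And>i. i \<in> A \<Longrightarrow> f i \<in> poly_functions s) \<Longrightarrow> (\<lambda>x. \<Sum>i\<in>A. f i x) \<in> poly_functions s"
  by (induction A rule: infinite_finite_induct)
     (simp_all add: poly_functions.const poly_functions.add poly_functions.mult)

lemma poly_functions_prod:
  "(\<And>i. i \<in> A \<Longrightarrow> f i \<in> poly_functions s) \<Longrightarrow> (\<lambda>x. \<Prod>i\<in>A. f i x) \<in> poly_functions s"
  by (induction A rule: infinite_finite_induct)
     (simp_all add: poly_functions.const poly_functions.add poly_functions.mult)

lemma poly_functions_power:
  "p \<in> poly_functions s \<Longrightarrow> (\<lambda>x. p x ^ n) \<in> poly_functions s"
  by (induction n) (simp_all add: poly_functions.const poly_functions.mult)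

lemma poly_functions_linear_comp:
  assumes "p \<in> poly_functions s" "Vector_Spaces.linear t s h"
  shows "(\<lambda>x. p (h x)) \<in> poly_functions t"
  using assms(1)
proof induction
  case (linear l)
  have "Vector_Spaces.linear t (*) (l \<circ> h)" by (rule Vector_Spaces.linear_compose[OF assms(2) linear])
  then show ?case using poly_functions.linear[of t "l \<circ> h"] by (simp add: o_def)
qed (simp_all add: poly_functions.const poly_functions.add poly_functions.mult)

lemma topspace_zariski [simp]: "topspace (zariski s) = UNIV"
proof -
  have "UNIV \<in> {{x. p x \<noteq> 0} |p. p \<in> poly_functions s}"
    using poly_functions.const[of 1 s] by (intro CollectI exI[of _ "\<lambda>_. 1"]) auto
  then show ?thesis unfolding zariski_def by auto
qed

lemma openin_zariski_nonzero: "p \<in> poly_functions s \<Longrightarrow> openin (zariski s) {x. p x \<noteq> 0}"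
  unfolding zariski_def by (rule topology_generated_by_Basis) auto

lemma closedin_zariski_zeros: "p \<in> poly_functions s \<Longrightarrow> closedin (zariski s) {x. p x = 0}"
  using openin_zariski_nonzero[of p s] by (simp add: closedin_def set_diff_eq)

text \<open>A product is nonzero exactly where both factors are, so the generating sets are closed
  under intersection and already form a basis.\<close>

lemma openin_zariski_basis:
  assumes "openin (zariski s) U" "x \<in> U"
  obtains p where "p \<in> poly_functions s" "p x \<noteq> 0" "\<And>y. p y \<noteq> 0 \<Longrightarrow> y \<in> U"
proof -
  have "generate_topology_on {{x. p x \<noteq> 0} |p. p \<in> poly_functions s} U"
    using assms(1) unfolding zariski_def by (rule openin_topology_generated_by)
  then have "x \<in> U \<longrightarrow> (\<exists>p\<in>poly_functions s. p x \<noteq> 0 \<and> (\<forall>y. p y \<noteq> 0 \<longrightarrow> y \<in> U))"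
  proof induction
    case (Int a b)
    show ?case
    proof
      assume "x \<in> a \<inter> b"
      then obtain p q where "p \<in> poly_functions s" "p x \<noteq> 0" "\<forall>y. p y \<noteq> 0 \<longrightarrow> y \<in> a"
        "q \<in> poly_functions s" "q x \<noteq> 0" "\<forall>y. q y \<noteq> 0 \<longrightarrow> y \<in> b"
        using Int by auto
      then show "\<exists>p\<in>poly_functions s. p x \<noteq> 0 \<and> (\<forall>y. p y \<noteq> 0 \<longrightarrow> y \<in> a \<inter> b)"
        by (intro bexI[of _ "\<lambda>x. p x * q x"]) (auto intro: poly_functions.mult)
    qed
  next
    case (UN K) then show ?case by blast
  qed auto
  then show ?thesis using assms(2) that by blast
qed

lemma closedin_zariski_separate:
  assumes "closedin (zariski s) C" "x \<notin> C"
  obtains p where "p \<in> poly_functions s" "p x \<noteq> 0" "\<And>y. y \<in> C \<Longrightarrow> p y = 0"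
proof -
  have "openin (zariski s) (- C)" using assms(1) by (simp add: closedin_def Compl_eq_Diff_UNIV)
  then obtain p where "p \<in> poly_functions s" "p x \<noteq> 0" "\<And>y. p y \<noteq> 0 \<Longrightarrow> y \<in> - C"
    using assms(2) by (elim openin_zariski_basis) auto
  then show ?thesis by (intro that[of p]) auto
qed

section \<open>Coordinates and evaluation of characters\<close>

text \<open>One notion for the abstract space with its basis and for the matrices with their
  entries, indexed by pairs.\<close>

definition linear_coordinates ::
    "(complex \<Rightarrow> 'v \<Rightarrow> 'v) \<Rightarrow> 'i set \<Rightarrow> ('i \<Rightarrow> 'v::ab_group_add) \<Rightarrow> ('i \<Rightarrow> 'v \<Rightarrow> complex) \<Rightarrow> bool" where
  "linear_coordinates s I e x \<longleftrightarrow> finite I \<and> (\<forall>i\<in>I. Vector_Spaces.linear s (*) (x i)) \<and>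
     (\<forall>v. v = (\<Sum>i\<in>I. s (x i v) (e i)))"

lemma linear_coordinates_expand:
  assumes "linear_coordinates s I e x" "Vector_Spaces.linear s (*) l"
  shows "l v = (\<Sum>i\<in>I. x i v * l (e i))"
proof -
  interpret l: Vector_Spaces.linear s "(*)" l by fact
  have "l v = l (\<Sum>i\<in>I. s (x i v) (e i))" using assms(1) by (simp add: linear_coordinates_def)
  also have "\<dots> = (\<Sum>i\<in>I. x i v * l (e i))" by (simp add: l.sum l.scale)
  finally show ?thesis .
qed

text \<open>A character is determined by its values on the coordinates, and those values are the
  coordinates of a point. The map \<pi> is the identity when a point of the space is sought, and a
  projection when the algebra consists of functions of two matrices.\<close>

lemma fun_hom_poly_functions:
  assumes x: "linear_coordinates s I e x" and \<theta>: "fun_hom (fun_algebra E) \<theta>"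
    and gen: "\<And>i. i \<in> I \<Longrightarrow> (\<lambda>y. x i (\<pi> y)) \<in> fun_algebra E" and "p \<in> poly_functions s"
  shows "(\<lambda>y. p (\<pi> y)) \<in> fun_algebra E \<and>
    \<theta> (\<lambda>y. p (\<pi> y)) = p (\<Sum>i\<in>I. s (\<theta> (\<lambda>y. x i (\<pi> y))) (e i))"
  using assms(4)
proof induction
  case (linear l)
  interpret l: Vector_Spaces.linear s "(*)" l by fact
  have eq: "(\<lambda>y. l (\<pi> y)) = (\<Sum>i\<in>I. (\<lambda>_. l (e i)) * (\<lambda>y. x i (\<pi> y)))"
    by (rule ext, subst linear_coordinates_expand[OF x linear]) (simp add: sum_fun_apply mult.commute)
  have mem: "(\<lambda>_. l (e i)) * (\<lambda>y. x i (\<pi> y)) \<in> fun_algebra E" if "i \<in> I" for i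
    using gen that by (intro fun_algebra.mult fun_algebra.const)
  \<comment> \<open>Additivity of \<theta> is given for two elements of the algebra, so a finite sum
    is built up along subsets of \<open>I\<close>.\<close>
  have "\<theta> (\<Sum>i\<in>J. (\<lambda>_. l (e i)) * (\<lambda>y. x i (\<pi> y))) = (\<Sum>i\<in>J. l (e i) * \<theta> (\<lambda>y. x i (\<pi> y)))"
    if "J \<subseteq> I" for J
  proof -
    have "finite J" using that x by (auto simp: linear_coordinates_def intro: finite_subset)
    then show ?thesis using that
    proof induction
      case empty
      show ?case using fun_homD(1)[OF \<theta>, of 0] by (simp add: zero_fun_def)
    next
      case (insert i J)
      have "\<theta> (\<Sum>i\<in>insert i J. (\<lambda>_. l (e i)) * (\<lambda>y. x i (\<pi> y)))
        = \<theta> ((\<lambda>_. l (e i)) * (\<lambda>y. x i (\<pi> y)) + (\<Sum>i\<in>J. (\<lambda>_. l (e i)) * (\<lambda>y. x i (\<pi> y))))"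
        using insert(1,2) by simp
      also have "\<dots> = \<theta> ((\<lambda>_. l (e i)) * (\<lambda>y. x i (\<pi> y))) + \<theta> (\<Sum>i\<in>J. (\<lambda>_. l (e i)) * (\<lambda>y. x i (\<pi> y)))"
        using insert(4) by (intro fun_homD(2)[OF \<theta>] mem fun_algebra_sum) auto
      also have "\<theta> ((\<lambda>_. l (e i)) * (\<lambda>y. x i (\<pi> y))) = l (e i) * \<theta> (\<lambda>y. x i (\<pi> y))"
        using insert(4) fun_homD(3)[OF \<theta> fun_algebra.const gen] fun_homD(1)[OF \<theta>] by auto
      finally show ?case using insert by simp
    qed
  qed
  from this[of I] show ?case unfolding eq
    by (auto simp: l.sum l.scale mult.commute intro!: fun_algebra_sum mem)
next
  case (const c)
  then show ?case using fun_homD(1)[OF \<theta>] by (auto intro: fun_algebra.const)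
next
  case (add p q)
  then show ?case
    using fun_algebra.add[of "\<lambda>y. p (\<pi> y)" E "\<lambda>y. q (\<pi> y)"] fun_homD(2)[OF \<theta>, of "\<lambda>y. p (\<pi> y)" "\<lambda>y. q (\<pi> y)"]
    by (simp add: plus_fun_def)
next
  case (mult p q)
  then show ?case
    using fun_algebra.mult[of "\<lambda>y. p (\<pi> y)" E "\<lambda>y. q (\<pi> y)"] fun_homD(3)[OF \<theta>, of "\<lambda>y. p (\<pi> y)" "\<lambda>y. q (\<pi> y)"]
    by (simp add: times_fun_def)
qed

lemma poly_functions_eq_fun_algebra:
  assumes x: "linear_coordinates s I e x"
  shows "poly_functions s = fun_algebra (x ` I)"
proof (rule equalityI)
  show "fun_algebra (x ` I) \<subseteq> poly_functions s"
  proof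
    fix f assume "f \<in> fun_algebra (x ` I)"
    then show "f \<in> poly_functions s"
    proof induction
      case (gen f)
      then show ?case using x poly_functions.linear by (auto simp: linear_coordinates_def)
    qed (simp_all only: poly_functions.const poly_functions_plus poly_functions_times)
  qed
  show "poly_functions s \<subseteq> fun_algebra (x ` I)"
  proof
    fix p assume "p \<in> poly_functions s"
    then show "p \<in> fun_algebra (x ` I)"
    proof induction
      case (linear l)
      have "l = (\<Sum>i\<in>I. (\<lambda>_. l (e i)) * x i)"
        by (rule ext, subst linear_coordinates_expand[OF x linear]) (simp add: sum_fun_apply mult.commute)
      moreover have "(\<Sum>i\<in>I. (\<lambda>_. l (e i)) * x i) \<in> fun_algebra (x ` I)"
        by (intro fun_algebra_sum fun_algebra.mult fun_algebra.const fun_algebra.gen) auto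
      ultimately show ?case by simp
    next
      case (add p q)
      then show ?case using fun_algebra.add[of p _ q] by (simp add: plus_fun_def)
    next
      case (mult p q)
      then show ?case using fun_algebra.mult[of p _ q] by (simp add: times_fun_def)
    qed (rule fun_algebra.const)
  qed
qed

lemma vector_space_complex_mult: "vector_space ((*) :: complex \<Rightarrow> complex \<Rightarrow> complex)"
  by unfold_locales (auto simp: algebra_simps)

lemma linear_coordinates_basis:
  assumes "finite_dimensional_vector_space s B"
  shows "linear_coordinates s B (\<lambda>b. b) (\<lambda>b v. module.representation s B v b)"
proof -
  interpret finite_dimensional_vector_space s B by fact
  have span: "v \<in> span B" for v using span_Basis by auto
  interpret vector_space_pair s "(*) :: complex \<Rightarrow> complex \<Rightarrow> complex"
    using vector_space_axioms vector_space_complex_mult by (simp add: vector_space_pair_def)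
  show ?thesis
    unfolding linear_coordinates_def
  proof (intro conjI ballI allI)
    show "finite B" by (rule finite_Basis)
    fix b
    show "Vector_Spaces.linear s (*) (\<lambda>v. representation B v b)"
      by unfold_locales (simp_all add: representation_add[OF independent_Basis span span] representation_scale[OF independent_Basis span])
  next
    fix v show "v = (\<Sum>b\<in>B. s (representation B v b) b)"
      using sum_representation_eq[OF independent_Basis span finite_Basis order_refl] by simp
  qed
qed

definition matrix_unit :: "'n \<times> 'n \<Rightarrow> complex^'n^'n" where
  "matrix_unit ij = (\<chi> k l. if (k, l) = ij then 1 else 0)"

lemma linear_coordinates_matrix:
  "linear_coordinates matrix_scale UNIV (matrix_unit :: 'n \<times> 'n \<Rightarrow> complex^'n^'n)
     (\<lambda>ij A. A $ fst ij $ snd ij)"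
proof -
  have vs: "vector_space (matrix_scale :: complex \<Rightarrow> complex^'n^'n \<Rightarrow> _)"
    by unfold_locales (auto simp: matrix_scale_def vec_eq_iff algebra_simps)
  interpret vector_space_pair "matrix_scale :: complex \<Rightarrow> complex^'n^'n \<Rightarrow> _" "(*) :: complex \<Rightarrow> complex \<Rightarrow> complex"
    using vs vector_space_complex_mult by (simp add: vector_space_pair_def)
  show ?thesis
    unfolding linear_coordinates_def
  proof (intro conjI ballI allI)
    fix ij :: "'n \<times> 'n"
    show "Vector_Spaces.linear matrix_scale (*) (\<lambda>A. A $ fst ij $ snd ij)"
      by unfold_locales (simp_all add: matrix_scale_def)
  next
    fix A :: "complex^'n^'n"
    have "A $ k $ l = (\<Sum>ij\<in>UNIV. matrix_scale (A $ fst ij $ snd ij) (matrix_unit ij)) $ k $ l" for k l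
    proof -
      have "(\<Sum>ij\<in>UNIV. matrix_scale (A $ fst ij $ snd ij) (matrix_unit ij)) $ k $ l
        = (\<Sum>ij\<in>UNIV. if ij = (k, l) then A $ k $ l else 0)"
        unfolding sum_component by (rule sum.cong) (auto simp: matrix_scale_def matrix_unit_def)
      then show ?thesis by simp
    qed
    then show "A = (\<Sum>ij\<in>UNIV. matrix_scale (A $ fst ij $ snd ij) (matrix_unit ij))"
      unfolding vec_eq_iff by blast
  qed simp
qed

lemma det_poly_function: "det \<in> poly_functions (matrix_scale :: complex \<Rightarrow> complex^'n^'n \<Rightarrow> _)"
proof -
  have "(\<lambda>A. A $ i $ j) \<in> poly_functions (matrix_scale :: complex \<Rightarrow> complex^'n^'n \<Rightarrow> _)" for i j
  proof (rule poly_functions.linear)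
    have "\<forall>ij\<in>UNIV. Vector_Spaces.linear matrix_scale (*) (\<lambda>A :: complex^'n^'n. A $ fst ij $ snd ij)"
      using linear_coordinates_matrix unfolding linear_coordinates_def by blast
    from bspec[OF this, of "(i, j)"]
    show "Vector_Spaces.linear matrix_scale (*) (\<lambda>A :: complex^'n^'n. A $ i $ j)" by simp
  qed
  then show ?thesis unfolding det_def[abs_def]
    by (intro poly_functions_sum poly_functions.mult poly_functions.const poly_functions_prod)
qed

text \<open>Rabinowitsch's trick, with \<open>1 / p\<close> realised as a function that vanishes where \<open>p\<close> does.\<close>
lemma poly_functions_nullstellensatz:
  assumes fd: "finite_dimensional_vector_space s B"
    and p: "p \<in> poly_functions s" and q: "q \<in> poly_functions s"
    and zero: "\<And>x. q x = 0 \<Longrightarrow> p x = 0"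
  obtains r n where "r \<in> poly_functions s" "\<And>x. p x ^ n = q x * r x"
proof -
  note x = linear_coordinates_basis[OF fd]
  let ?x = "\<lambda>b v. module.representation s B v b"
  let ?A = "poly_functions s"
  have "finite B" using x by (simp add: linear_coordinates_def)
  let ?u = "\<lambda>x. inverse (p x)"
  let ?E = "insert ?u (?x ` B)"
  let ?F = "fun_algebra ?E"
  \<comment> \<open>\<open>P f n a\<close> reads \<open>f = q a / p^n\<close> where \<open>p\<close>
    is nonzero. Thus \<open>I\<close> is the ideal generated by \<open>q\<close> once
    \<open>p\<close> is inverted, tested only off the zeros of \<open>p\<close>.\<close>
  define P where "P = (\<lambda>f n a. a \<in> ?A \<and> (\<forall>x. p x \<noteq> 0 \<longrightarrow> f x * p x ^ n = q x * a x))"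
  define I where "I = {f \<in> ?F. \<exists>n a. P f n a}"
  have frac: "\<exists>n. \<exists>a\<in>?A. \<forall>x. p x \<noteq> 0 \<longrightarrow> f x * p x ^ n = a x" if "f \<in> ?F" for f
    using that
  proof induction
    case (gen f)
    show ?case
    proof (cases "f = ?u")
      case True
      then show ?thesis
        by (intro exI[of _ "1::nat"] bexI[of _ "\<lambda>_. 1"]) (auto intro: poly_functions.const)
    next
      case False
      then have "f \<in> ?A" using gen x by (auto simp: linear_coordinates_def intro: poly_functions.linear)
      then show ?thesis by (intro exI[of _ "0::nat"] bexI[of _ f]) auto
    qed
  next
    case (const c)
    show ?case
      by (intro exI[of _ "0::nat"] bexI[of _ "\<lambda>_. c"]) (auto intro: poly_functions.const)
  next
    case (add f g)
    then obtain n a m b where "a \<in> ?A" "b \<in> ?A" "\<And>x. p x \<noteq> 0 \<Longrightarrow> f x * p x ^ n = a x"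
      "\<And>x. p x \<noteq> 0 \<Longrightarrow> g x * p x ^ m = b x" by metis
    then show ?case using p
      by (intro exI[of _ "n + m"] bexI[of _ "\<lambda>x. a x * p x ^ m + b x * p x ^ n"])
         (auto simp: algebra_simps power_add intro!: poly_functions.add poly_functions.mult poly_functions_power
           simp flip: \<open>\<And>x. p x \<noteq> 0 \<Longrightarrow> f x * p x ^ n = a x\<close> \<open>\<And>x. p x \<noteq> 0 \<Longrightarrow> g x * p x ^ m = b x\<close>)
  next
    case (mult f g)
    then obtain n a m b where "a \<in> ?A" "b \<in> ?A" "\<And>x. p x \<noteq> 0 \<Longrightarrow> f x * p x ^ n = a x"
      "\<And>x. p x \<noteq> 0 \<Longrightarrow> g x * p x ^ m = b x" by metis
    then show ?case
      by (intro exI[of _ "n + m"] bexI[of _ "\<lambda>x. a x * b x"])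
         (auto simp: algebra_simps power_add intro!: poly_functions.mult
           simp flip: \<open>\<And>x. p x \<noteq> 0 \<Longrightarrow> f x * p x ^ n = a x\<close> \<open>\<And>x. p x \<noteq> 0 \<Longrightarrow> g x * p x ^ m = b x\<close>)
  qed
  have I: "fun_ideal ?F I"
    unfolding fun_ideal_def
  proof (intro conjI ballI)
    show "I \<subseteq> ?F" by (auto simp: I_def)
    have "P 0 0 (\<lambda>_. 0)" by (auto simp: P_def intro: poly_functions.const)
    then show "0 \<in> I" using fun_algebra_0 by (auto simp: I_def)
  next
    fix f g assume "f \<in> I" "g \<in> I"
    then obtain n a m b where fg: "f \<in> ?F" "g \<in> ?F" "P f n a" "P g m b" by (auto simp: I_def)
    have "P (f + g) (n + m) (\<lambda>x. a x * p x ^ m + b x * p x ^ n)"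
      unfolding P_def
    proof (intro conjI allI impI)
      show "(\<lambda>x. a x * p x ^ m + b x * p x ^ n) \<in> ?A"
        using fg p by (intro poly_functions.add poly_functions.mult poly_functions_power) (auto simp: P_def)
      fix x assume "p x \<noteq> 0"
      then have "f x * p x ^ n = q x * a x" "g x * p x ^ m = q x * b x" using fg by (auto simp: P_def)
      then have "(f x * p x ^ n) * p x ^ m + (g x * p x ^ m) * p x ^ n = q x * (a x * p x ^ m + b x * p x ^ n)"
        by (simp add: algebra_simps)
      then show "(f + g) x * p x ^ (n + m) = q x * (a x * p x ^ m + b x * p x ^ n)"
        by (simp add: algebra_simps power_add)
    qed
    then show "f + g \<in> I" using fun_algebra.add[OF fg(1,2)] unfolding I_def by blast
  next
    fix f g assume "f \<in> ?F" "g \<in> I"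
    then obtain m b where fg: "f \<in> ?F" "g \<in> ?F" "P g m b" by (auto simp: I_def)
    obtain n a where a: "a \<in> ?A" "\<And>x. p x \<noteq> 0 \<Longrightarrow> f x * p x ^ n = a x" using frac[OF fg(1)] by blast
    have "P (f * g) (n + m) (\<lambda>x. a x * b x)"
      unfolding P_def
    proof (intro conjI allI impI)
      show "(\<lambda>x. a x * b x) \<in> ?A" using fg a by (intro poly_functions.mult) (auto simp: P_def)
      fix x assume "p x \<noteq> 0"
      then have "f x * p x ^ n = a x" "g x * p x ^ m = q x * b x" using fg a by (auto simp: P_def)
      then have "(f x * p x ^ n) * (g x * p x ^ m) = q x * (a x * b x)" by simp
      then show "(f * g) x * p x ^ (n + m) = q x * (a x * b x)" by (simp add: algebra_simps power_add)
    qed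
    then show "f * g \<in> I" using fun_algebra.mult[OF fg(1,2)] unfolding I_def by blast
  qed
  have "1 \<in> I"
  proof (rule ccontr)
    assume "1 \<notin> I"
    moreover have "countable ?E" using \<open>finite B\<close> by (simp add: countable_finite)
    ultimately obtain \<theta> where \<theta>: "fun_hom ?F \<theta>" "\<And>f. f \<in> I \<Longrightarrow> \<theta> f = 0"
      using fun_algebra_nullstellensatz I by blast
    \<comment> \<open>On polynomials the character is evaluation at this point; \<open>?u\<close> is
      no polynomial, and its value is tied to \<open>p w\<close> only by the relation
      \<open>p * ?u = 1\<close> modulo \<open>I\<close>.\<close>
    define w where "w = (\<Sum>b\<in>B. s (\<theta> (?x b)) b)"
    have ev: "f \<in> ?F \<and> \<theta> f = f w" if "f \<in> ?A" for f
      using fun_hom_poly_functions[OF x \<theta>(1), of "\<lambda>y. y" f] that unfolding w_def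
      by (auto intro: fun_algebra.gen)
    have u: "?u \<in> ?F" by (rule fun_algebra.gen) simp
    have "P q 0 (\<lambda>_. 1)" by (auto simp: P_def intro: poly_functions.const)
    then have "q \<in> I" using ev[OF q] unfolding I_def by blast
    then have "q w = 0" using \<theta>(2) ev[OF q] by simp
    then have "p w = 0" by (rule zero)
    \<comment> \<open>At a zero of \<open>p\<close> this function is -1, as \<open>?u\<close>
      vanishes there; it lies in \<open>I\<close> all the same because \<open>P\<close> ignores such
      points.\<close>
    have "P (p * ?u - (\<lambda>_. 1)) 0 (\<lambda>_. 0)" by (auto simp: P_def intro: poly_functions.const)
    then have "p * ?u - (\<lambda>_. 1) \<in> I"
      using fun_algebra_diff[OF fun_algebra.mult[OF conjunct1[OF ev[OF p]] u] fun_algebra.const] unfolding I_def by blast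
    then have "\<theta> p * \<theta> ?u - 1 = 0"
      using fun_hom_diff[OF \<theta>(1) fun_algebra.mult[OF conjunct1[OF ev[OF p]] u] fun_algebra.const]
        fun_homD[OF \<theta>(1)] ev[OF p] u \<theta>(2) by metis
    then show False using ev[OF p] \<open>p w = 0\<close> by simp
  qed
  then obtain n a where a: "a \<in> ?A" "\<And>x. p x \<noteq> 0 \<Longrightarrow> p x ^ n = q x * a x"
    by (auto simp: I_def P_def)
  show ?thesis
  proof
    \<comment> \<open>The identity for \<open>a\<close> is known only where \<open>p\<close> is
      nonzero. One more factor \<open>p\<close> makes both sides vanish elsewhere, whence the
      exponent \<open>Suc n\<close>.\<close>
    show "(\<lambda>x. a x * p x) \<in> ?A" using a p by (intro poly_functions.mult)
    show "p x ^ Suc n = q x * (a x * p x)" for x using a(2)[of x] by (cases "p x = 0") auto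
  qed
qed

section \<open>Closed orbits\<close>

text \<open>Over the fraction field of \<open>A\<close>, solve for one \<open>b\<close> at a time: either the
  identity at some fixed \<open>g\<close> expresses \<open>b\<close> through the others, or \<open>a\<close> kills its coefficient.
  In the end \<open>a\<close> vanishes on the image of \<open>\<psi>\<close>, which is as dense as that of \<open>\<phi>\<close>.\<close>
lemma dense_images_no_identity:
  fixes a :: "'v \<Rightarrow> complex"
  assumes add: "\<And>p q. p \<in> A \<Longrightarrow> q \<in> A \<Longrightarrow> (\<lambda>y. p y + q y) \<in> A"
    and diff: "\<And>p q. p \<in> A \<Longrightarrow> q \<in> A \<Longrightarrow> (\<lambda>y. p y - q y) \<in> A"
    and mult: "\<And>p q. p \<in> A \<Longrightarrow> q \<in> A \<Longrightarrow> (\<lambda>y. p y * q y) \<in> A"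
    and dense: "\<And>p. p \<in> A \<Longrightarrow> (\<forall>g\<in>G. p (\<phi> g) = 0) \<longleftrightarrow> (\<forall>h\<in>H. p (\<psi> h) = 0)"
    and a: "a \<in> A" "g1 \<in> G" "a (\<phi> g1) \<noteq> 0"
    and c0: "\<And>g. g \<in> G \<Longrightarrow> c0 g \<in> A \<and> c0 g (\<phi> g) = 0"
    and c: "\<And>c b g. (c, b) \<in> set xs \<Longrightarrow> g \<in> G \<Longrightarrow> c g \<in> A \<and> c g (\<phi> g) = 0"
    and eq: "\<And>g h. g \<in> G \<Longrightarrow> h \<in> H \<Longrightarrow> a (\<psi> h) = c0 g (\<psi> h) + (\<Sum>(c, b)\<leftarrow>xs. c g (\<psi> h) * b h)"
  shows False
  using a c0 c eq
proof (induction "length xs" arbitrary: xs a c0 g1)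
  case 0
  \<comment> \<open>With no \<open>b\<close> left, \<open>a - c0 g1\<close> vanishes on the image of
    \<psi>, hence at \<open>\<phi> g1\<close>, where \<open>c0 g1\<close> is zero and
    \<open>a\<close> is not.\<close>
  have "(\<lambda>y. a y - c0 g1 y) \<in> A" using 0 by (intro diff) auto
  moreover have "\<forall>h\<in>H. a (\<psi> h) - c0 g1 (\<psi> h) = 0" using 0 by auto
  ultimately have "a (\<phi> g1) - c0 g1 (\<phi> g1) = 0" using dense[of "\<lambda>y. a y - c0 g1 y"] 0(3) by auto
  then show False using 0 by auto
next
  case (Suc n)
  obtain c' b' ys where xs: "xs = (c', b') # ys" using Suc(2) by (cases xs) auto
  note a = Suc.prems(1,2,3) and c0 = Suc.prems(4)
  have c': "\<And>g. g \<in> G \<Longrightarrow> c' g \<in> A \<and> c' g (\<phi> g) = 0"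
    and ys: "\<And>c b g. (c, b) \<in> set ys \<Longrightarrow> g \<in> G \<Longrightarrow> c g \<in> A \<and> c g (\<phi> g) = 0"
    using Suc.prems(5) unfolding xs by auto
  have eq: "\<And>g h. g \<in> G \<Longrightarrow> h \<in> H \<Longrightarrow>
      a (\<psi> h) = c0 g (\<psi> h) + c' g (\<psi> h) * b' h + (\<Sum>(c, b)\<leftarrow>ys. c g (\<psi> h) * b h)"
    using Suc.prems(6) unfolding xs by (simp add: algebra_simps)
  \<comment> \<open>The test includes the factor \<open>a\<close> because \<open>c' g0 * a\<close>
    becomes the new left side and must again be nonzero somewhere on the image of \<phi>.\<close>
  show False
  proof (cases "\<exists>g0\<in>G. \<exists>g\<in>G. c' g0 (\<phi> g) * a (\<phi> g) \<noteq> 0")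
    case True
    then obtain g0 g2 where g0: "g0 \<in> G" "g2 \<in> G" "c' g0 (\<phi> g2) * a (\<phi> g2) \<noteq> 0" by blast
    let ?ys = "map (\<lambda>(c, b). (\<lambda>g y. c g y * c' g0 y - c' g y * c g0 y, b)) ys"
    \<comment> \<open>This is why the identity carries a term \<open>c0\<close> without any
      \<open>b\<close>: replacing \<open>c' g0 * b'\<close> by the remaining terms at
      \<open>g0\<close> creates \<open>c' g * a\<close>, which vanishes at \<open>\<phi> g\<close>
      because \<open>c' g\<close> does.\<close>
    let ?c0 = "\<lambda>g y. c0 g y * c' g0 y - c' g y * c0 g0 y + c' g y * a y"
    show False
    proof (rule Suc.hyps(1)[of ?ys "\<lambda>y. c' g0 y * a y" g2 ?c0])
      show "n = length ?ys" using Suc(2) xs by simp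
      show "(\<lambda>y. c' g0 y * a y) \<in> A" using c' g0 a by (intro mult) auto
      show "?c0 g \<in> A \<and> ?c0 g (\<phi> g) = 0" if "g \<in> G" for g
        using c' c0 g0 a that by (auto intro!: add diff mult)
      show "c g \<in> A \<and> c g (\<phi> g) = 0" if cb: "(c, b) \<in> set ?ys" "g \<in> G" for c b g
      proof -
        obtain d where "(d, b) \<in> set ys" "c = (\<lambda>g y. d g y * c' g0 y - c' g y * d g0 y)"
          using cb by auto
        then show ?thesis using c' ys[of d b] g0 cb by (auto intro!: diff mult)
      qed
      fix g h assume gh: "g \<in> G" "h \<in> H"
      have map: "(\<Sum>(c, b)\<leftarrow>?ys. c g (\<psi> h) * b h) =
          c' g0 (\<psi> h) * (\<Sum>(c, b)\<leftarrow>ys. c g (\<psi> h) * b h) - c' g (\<psi> h) * (\<Sum>(c, b)\<leftarrow>ys. c g0 (\<psi> h) * b h)"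
        by (induction ys) (auto simp: algebra_simps)
      have "c' g0 (\<psi> h) * a (\<psi> h) = c' g0 (\<psi> h) * (c0 g (\<psi> h) + (\<Sum>(c, b)\<leftarrow>ys. c g (\<psi> h) * b h))
          + c' g (\<psi> h) * (c' g0 (\<psi> h) * b' h)"
        by (subst eq[OF gh]) (simp add: algebra_simps)
      also have "c' g0 (\<psi> h) * b' h = a (\<psi> h) - c0 g0 (\<psi> h) - (\<Sum>(c, b)\<leftarrow>ys. c g0 (\<psi> h) * b h)"
        using eq[OF g0(1) gh(2)] by (simp add: algebra_simps)
      finally show "c' g0 (\<psi> h) * a (\<psi> h) = ?c0 g (\<psi> h) + (\<Sum>(c, b)\<leftarrow>?ys. c g (\<psi> h) * b h)"
        unfolding map by (simp add: algebra_simps)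
    qed (use g0 in auto)
  next
    case False
    \<comment> \<open>The vanishing of \<open>c' g * a\<close> passes from the image of \<phi> to
      that of \<psi> by \<open>dense\<close>.\<close>
    have kill: "c' g (\<psi> h) * a (\<psi> h) = 0" if "g \<in> G" "h \<in> H" for g h
      using dense[of "\<lambda>y. c' g y * a y"] False mult[of "c' g" a] c' a that by blast
    let ?ys = "map (\<lambda>(c, b). (\<lambda>g y. a y * c g y, b)) ys"
    show False
    proof (rule Suc.hyps(1)[of ?ys "\<lambda>y. a y * a y" g1 "\<lambda>g y. a y * c0 g y"])
      show "n = length ?ys" using Suc(2) xs by simp
      show "(\<lambda>y. a y * a y) \<in> A" using a by (intro mult)
      show "(\<lambda>y. a y * c0 g y) \<in> A \<and> a (\<phi> g) * c0 g (\<phi> g) = 0" if "g \<in> G" for g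
        using c0 a that by (auto intro!: mult)
      show "c g \<in> A \<and> c g (\<phi> g) = 0" if cb: "(c, b) \<in> set ?ys" "g \<in> G" for c b g
      proof -
        obtain d where "(d, b) \<in> set ys" "c = (\<lambda>g y. a y * d g y)"
          using cb by auto
        then show ?thesis using a ys[of d b] cb by (auto intro!: mult)
      qed
      fix g h assume gh: "g \<in> G" "h \<in> H"
      have map: "(\<Sum>(c, b)\<leftarrow>?ys. c g (\<psi> h) * b h) = a (\<psi> h) * (\<Sum>(c, b)\<leftarrow>ys. c g (\<psi> h) * b h)"
        by (induction ys) (auto simp: algebra_simps)
      have "a (\<psi> h) * a (\<psi> h) = a (\<psi> h) * (c0 g (\<psi> h) + (\<Sum>(c, b)\<leftarrow>ys. c g (\<psi> h) * b h))
          + c' g (\<psi> h) * a (\<psi> h) * b' h"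
        by (subst (2) eq[OF gh]) (simp add: algebra_simps)
      then show "a (\<psi> h) * a (\<psi> h) = a (\<psi> h) * c0 g (\<psi> h) + (\<Sum>(c, b)\<leftarrow>?ys. c g (\<psi> h) * b h)"
        unfolding map kill[OF gh] by (simp add: algebra_simps)
    qed (use a in auto)
  qed
qed

text \<open>If the images are disjoint, the differences of coordinates generate the unit ideal on \<open>G \<times> G\<close>,
  which is an identity excluded by the preceding lemma.\<close>
lemma dense_images_meet:
  fixes G :: "(complex^'n^'n) set" and \<phi> \<psi> :: "complex^'n^'n \<Rightarrow> 'v::ab_group_add"
  assumes fd: "finite_dimensional_vector_space s B" and G: "linear_algebraic_group G"
    and \<phi>: "\<And>l. Vector_Spaces.linear s (*) l \<Longrightarrow>
      \<exists>p\<in>poly_functions matrix_scale. \<exists>k::nat. \<forall>g\<in>G. l (\<phi> g) = p g / det g ^ k"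
    and \<psi>: "\<And>l. Vector_Spaces.linear s (*) l \<Longrightarrow>
      \<exists>p\<in>poly_functions matrix_scale. \<exists>k::nat. \<forall>g\<in>G. l (\<psi> g) = p g / det g ^ k"
    and dense: "\<And>p. p \<in> poly_functions s \<Longrightarrow> (\<forall>g\<in>G. p (\<phi> g) = 0) \<longleftrightarrow> (\<forall>h\<in>G. p (\<psi> h) = 0)"
  obtains g h where "g \<in> G" "h \<in> G" "\<phi> g = \<psi> h"
proof -
  let ?ms = "matrix_scale :: complex \<Rightarrow> complex^'n^'n \<Rightarrow> complex^'n^'n"
  let ?A = "poly_functions s"
  \<comment> \<open>Entries and inverse determinant generate the regular functions on invertible
    matrices; \<open>E\<close> takes them in each of two variables.\<close>
  define E1 :: "(complex^'n^'n \<Rightarrow> complex) set"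
    where "E1 = insert (\<lambda>g. inverse (det g)) (range (\<lambda>ij A. A $ fst ij $ snd ij))"
  define E :: "((complex^'n^'n) \<times> (complex^'n^'n) \<Rightarrow> complex) set"
    where "E = (\<lambda>a x. a (fst x)) ` E1 \<union> (\<lambda>b x. b (snd x)) ` E1"
  let ?F = "fun_algebra E"
  \<comment> \<open>A polynomial \<open>c g\<close> vanishing at \<open>\<phi> g\<close>, taken at
    \<open>\<psi> h\<close>, is a combination of differences of coordinates of the two points.
    Regularity is asked only in the variable \<open>y\<close>; the dependence of \<open>c\<close> on
    \<open>g\<close> and of \<open>b\<close> on \<open>h\<close> is arbitrary, which makes
    \<open>T\<close> stable under multiplication by any function of one of the two
    variables.\<close>
  define R where "R = (\<lambda>f xs. (\<forall>(c, b)\<in>set xs. \<forall>g\<in>G. c g \<in> ?A \<and> c g (\<phi> g) = 0) \<and>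
    (\<forall>g\<in>G. \<forall>h\<in>G. f (g, h) = (\<Sum>(c, b)\<leftarrow>xs. c g (\<psi> h) * b h)))"
  define T where "T = {f. \<exists>xs. R f xs}"
  have TI: "f \<in> T" if "\<And>c b g. (c, b) \<in> set xs \<Longrightarrow> g \<in> G \<Longrightarrow> c g \<in> ?A \<and> c g (\<phi> g) = 0"
    "\<And>g h. g \<in> G \<Longrightarrow> h \<in> G \<Longrightarrow> f (g, h) = (\<Sum>(c, b)\<leftarrow>xs. c g (\<psi> h) * b h)" for f xs
    unfolding T_def R_def using that by (intro CollectI exI[of _ xs]) auto
  have RD1: "c g \<in> ?A \<and> c g (\<phi> g) = 0" if "R f xs" "(c, b) \<in> set xs" "g \<in> G" for f xs c b g
    using that unfolding R_def by blast
  have RD2: "f (g, h) = (\<Sum>(c, b)\<leftarrow>xs. c g (\<psi> h) * b h)" if "R f xs" "g \<in> G" "h \<in> G" for f xs g h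
    using that unfolding R_def by blast
  \<comment> \<open>The empty list brings in the equations of \<open>G\<close> and the relation
    between the determinant and its inverse.\<close>
  have T_vanish: "f \<in> T" if "\<And>g h. g \<in> G \<Longrightarrow> h \<in> G \<Longrightarrow> f (g, h) = 0" for f
    using that by (intro TI[of "[]"]) auto
  have T_add: "f1 + f2 \<in> T" if f: "f1 \<in> T" "f2 \<in> T" for f1 f2
  proof -
    obtain xs where "R f1 xs" using f(1) by (auto simp: T_def)
    note xs = RD1[OF this] RD2[OF this]
    obtain ys where "R f2 ys" using f(2) by (auto simp: T_def)
    note ys = RD1[OF this] RD2[OF this]
    show ?thesis by (rule TI[of "xs @ ys"]) (use xs ys in auto)
  qed
  have T_fst: "(\<lambda>x. a (fst x)) * f \<in> T" if f: "f \<in> T" for a f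
  proof -
    obtain xs where "R f xs" using f by (auto simp: T_def)
    note xs = RD1[OF this] RD2[OF this]
    show ?thesis
    proof (rule TI[of "map (\<lambda>(c, b). (\<lambda>g y. a g * c g y, b)) xs"])
      fix c b g assume "(c, b) \<in> set (map (\<lambda>(c, b). (\<lambda>g y. a g * c g y, b)) xs)" "g \<in> G"
      then obtain d where "c = (\<lambda>g y. a g * d g y)" "d g \<in> ?A \<and> d g (\<phi> g) = 0" using xs(1) by auto
      then show "c g \<in> ?A \<and> c g (\<phi> g) = 0"
        using poly_functions.mult[OF poly_functions.const, of "d g" s "a g"] by simp
    next
      fix g h assume gh: "g \<in> G" "h \<in> G"
      have "(\<Sum>(c, b)\<leftarrow>map (\<lambda>(c, b). (\<lambda>g y. a g * c g y, b)) xs. c g (\<psi> h) * b h)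
        = a g * (\<Sum>(c, b)\<leftarrow>xs. c g (\<psi> h) * b h)"
        by (induction xs) (auto simp: algebra_simps)
      then show "((\<lambda>x. a (fst x)) * f) (g, h) =
        (\<Sum>(c, b)\<leftarrow>map (\<lambda>(c, b). (\<lambda>g y. a g * c g y, b)) xs. c g (\<psi> h) * b h)"
        using xs(2)[OF gh] by simp
    qed
  qed
  have T_snd: "(\<lambda>x. a (snd x)) * f \<in> T" if f: "f \<in> T" for a f
  proof -
    obtain xs where "R f xs" using f by (auto simp: T_def)
    note xs = RD1[OF this] RD2[OF this]
    show ?thesis
    proof (rule TI[of "map (\<lambda>(c, b). (c, \<lambda>h. a h * b h)) xs"])
      fix c b g assume "(c, b) \<in> set (map (\<lambda>(c, b). (c, \<lambda>h. a h * b h)) xs)" "g \<in> G"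
      then show "c g \<in> ?A \<and> c g (\<phi> g) = 0" using xs(1) by auto
    next
      fix g h assume gh: "g \<in> G" "h \<in> G"
      have "(\<Sum>(c, b)\<leftarrow>map (\<lambda>(c, b). (c, \<lambda>h. a h * b h)) xs. c g (\<psi> h) * b h)
        = a h * (\<Sum>(c, b)\<leftarrow>xs. c g (\<psi> h) * b h)"
        by (induction xs) (auto simp: algebra_simps)
      then show "((\<lambda>x. a (snd x)) * f) (g, h) =
        (\<Sum>(c, b)\<leftarrow>map (\<lambda>(c, b). (c, \<lambda>h. a h * b h)) xs. c g (\<psi> h) * b h)"
        using xs(2)[OF gh] by simp
    qed
  qed
  have T_mult: "u * f \<in> T" if "u \<in> ?F" "f \<in> T" for u f
    using that
  proof (induction arbitrary: f)
    case (gen u)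
    then consider a where "u = (\<lambda>x. a (fst x))" | a where "u = (\<lambda>x. a (snd x))"
      by (auto simp: E_def)
    then show ?case by cases (simp_all only: T_fst[OF gen(2)] T_snd[OF gen(2)])
  next
    case (const c)
    then show ?case by (rule T_fst)
  next
    case (add u v)
    then show ?case using T_add[of "u * f" "v * f"] by (simp only: distrib_right)
  next
    case (mult u v)
    then show ?case by (simp only: mult.assoc)
  qed
  define I where "I = ?F \<inter> T"
  have I: "fun_ideal ?F I"
    unfolding fun_ideal_def I_def
  proof (intro conjI ballI)
    show "0 \<in> ?F \<inter> T" using fun_algebra_0 T_vanish[of 0] by simp
  next
    fix f g assume "f \<in> ?F \<inter> T" "g \<in> ?F \<inter> T"
    then show "f + g \<in> ?F \<inter> T" using fun_algebra.add T_add by (metis IntD1 IntD2 IntI)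
  next
    fix f g assume "f \<in> ?F" "g \<in> ?F \<inter> T"
    then show "f * g \<in> ?F \<inter> T" using fun_algebra.mult T_mult by (metis IntD1 IntD2 IntI)
  qed simp
  have subG: "subgroup G GL" using G by (simp add: linear_algebraic_group_def)
  have one: "mat 1 \<in> G" using subgroup.one_closed[OF subG] by (simp add: GL_def)
  have inv: "invertible g" if "g \<in> G" for g using subgroup.mem_carrier[OF subG that] by (simp add: GL_def)
  have "1 \<notin> I"
  proof
    assume "1 \<in> I"
    then have "1 \<in> T" by (simp add: I_def)
    then obtain xs where "R 1 xs" by (auto simp: T_def)
    note xs = RD1[OF this] RD2[OF this]
    show False
      by (rule dense_images_no_identity[of ?A G \<phi> G \<psi> "\<lambda>_. 1" "mat 1" "\<lambda>_ _. 0" xs])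
         (use xs one dense in \<open>simp_all add: poly_functions.const poly_functions.add poly_functions.mult poly_functions_diff\<close>)
  qed
  moreover have "countable E" unfolding E_def E1_def by auto
  ultimately obtain \<theta> where \<theta>: "fun_hom ?F \<theta>" "\<And>f. f \<in> I \<Longrightarrow> \<theta> f = 0"
    using fun_algebra_nullstellensatz I by blast
  \<comment> \<open>On functions of one factor the character is evaluation at a matrix. Its
    determinant is invertible with inverse \<open>\<theta> ?u\<close>, and it lies in
    \<open>G\<close> because polynomials vanishing on \<open>G\<close> yield elements of
    \<open>I\<close>.\<close>
  have point: "\<exists>g0\<in>G. \<forall>p\<in>poly_functions ?ms. \<forall>k. (\<lambda>x. p (\<pi> x) / det (\<pi> x) ^ k) \<in> ?F \<and>
      \<theta> (\<lambda>x. p (\<pi> x) / det (\<pi> x) ^ k) = p g0 / det g0 ^ k"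
    if \<pi>: "\<And>a. a \<in> E1 \<Longrightarrow> (\<lambda>x. a (\<pi> x)) \<in> E" "\<And>x. fst x \<in> G \<Longrightarrow> snd x \<in> G \<Longrightarrow> \<pi> x \<in> G" for \<pi>
  proof -
    define g0 where "g0 = (\<Sum>ij\<in>UNIV. ?ms (\<theta> (\<lambda>x. \<pi> x $ fst ij $ snd ij)) (matrix_unit ij))"
    have ev: "(\<lambda>x. p (\<pi> x)) \<in> ?F \<and> \<theta> (\<lambda>x. p (\<pi> x)) = p g0" if "p \<in> poly_functions ?ms" for p
      unfolding g0_def
      by (rule fun_hom_poly_functions[OF linear_coordinates_matrix \<theta>(1) fun_algebra.gen[OF \<pi>(1)] that])
         (auto simp: E1_def)
    let ?u = "\<lambda>x. inverse (det (\<pi> x))"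
    have u: "?u \<in> ?F" by (rule fun_algebra.gen[OF \<pi>(1)]) (simp add: E1_def)
    note d = ev[OF det_poly_function]
    have "(\<lambda>x. det (\<pi> x)) * ?u - (\<lambda>_. 1) \<in> I"
      unfolding I_def using d u \<pi>(2) inv
      by (intro IntI fun_algebra_diff fun_algebra.mult fun_algebra.const T_vanish)
         (auto simp: invertible_det_nz)
    then have "det g0 * \<theta> ?u - 1 = 0"
      using fun_hom_diff[OF \<theta>(1) fun_algebra.mult[OF conjunct1[OF d] u] fun_algebra.const]
        fun_homD[OF \<theta>(1)] d u \<theta>(2) by metis
    then have nz: "det g0 \<noteq> 0" and \<theta>u: "\<theta> ?u = inverse (det g0)"
      using inverse_unique[of "det g0" "\<theta> ?u"] by auto
    have "g0 \<in> G"
    proof (rule ccontr)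
      assume "g0 \<notin> G"
      obtain C where C: "closedin (zariski ?ms) C" "G = carrier GL \<inter> C"
        using G unfolding linear_algebraic_group_def zariski_GL_def closedin_subtopology by blast
      have "g0 \<notin> C" using nz \<open>g0 \<notin> G\<close> C(2) by (auto simp: GL_def invertible_det_nz)
      then obtain p where p: "p \<in> poly_functions ?ms" "p g0 \<noteq> 0" "\<And>y. y \<in> C \<Longrightarrow> p y = 0"
        using closedin_zariski_separate[OF C(1)] by blast
      have "(\<lambda>x. p (\<pi> x)) \<in> I"
        unfolding I_def using ev[OF p(1)] p(3) \<pi>(2) C(2) by (intro IntI T_vanish) auto
      then show False using \<theta>(2) ev[OF p(1)] p(2) by simp
    qed
    moreover have "(\<lambda>x. p (\<pi> x) / det (\<pi> x) ^ k) \<in> ?F \<and>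
      \<theta> (\<lambda>x. p (\<pi> x) / det (\<pi> x) ^ k) = p g0 / det g0 ^ k" if p: "p \<in> poly_functions ?ms" for p k
    proof -
      have eq: "(\<lambda>x. p (\<pi> x) / det (\<pi> x) ^ k) = (\<lambda>x. p (\<pi> x)) * ?u ^ k"
        by (auto simp: fun_eq_iff power_fun_apply divide_inverse power_inverse)
      have uk: "?u ^ k \<in> ?F" using u by (rule fun_algebra_power)
      have "\<theta> ((\<lambda>x. p (\<pi> x)) * ?u ^ k) = p g0 * inverse (det g0) ^ k"
        using fun_homD(3)[OF \<theta>(1) conjunct1[OF ev[OF p]] uk] fun_hom_power[OF \<theta>(1) u] \<theta>u ev[OF p]
        by simp
      then show ?thesis unfolding eq using fun_algebra.mult[OF conjunct1[OF ev[OF p]] uk]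
        by (simp add: divide_inverse power_inverse)
    qed
    ultimately show ?thesis by blast
  qed
  obtain g0 where g0: "g0 \<in> G" "\<And>p k. p \<in> poly_functions ?ms \<Longrightarrow> (\<lambda>x. p (fst x) / det (fst x) ^ k) \<in> ?F"
    "\<And>p k. p \<in> poly_functions ?ms \<Longrightarrow> \<theta> (\<lambda>x. p (fst x) / det (fst x) ^ k) = p g0 / det g0 ^ k"
    using point[of fst] by (auto simp: E_def)
  obtain h0 where h0: "h0 \<in> G" "\<And>p k. p \<in> poly_functions ?ms \<Longrightarrow> (\<lambda>x. p (snd x) / det (snd x) ^ k) \<in> ?F"
    "\<And>p k. p \<in> poly_functions ?ms \<Longrightarrow> \<theta> (\<lambda>x. p (snd x) / det (snd x) ^ k) = p h0 / det h0 ^ k"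
    using point[of snd] by (auto simp: E_def)
  have eq: "l (\<phi> g0) = l (\<psi> h0)" if l: "Vector_Spaces.linear s (*) l" for l
  proof -
    obtain p k where p: "p \<in> poly_functions ?ms" "\<And>g. g \<in> G \<Longrightarrow> l (\<phi> g) = p g / det g ^ k" using \<phi>[OF l] by blast
    obtain q m where q: "q \<in> poly_functions ?ms" "\<And>g. g \<in> G \<Longrightarrow> l (\<psi> g) = q g / det g ^ m" using \<psi>[OF l] by blast
    let ?f = "(\<lambda>x. p (fst x) / det (fst x) ^ k) - (\<lambda>x. q (snd x) / det (snd x) ^ m)"
    \<comment> \<open>One term suffices: the coefficient \<open>l (\<phi> g) - l y\<close> vanishes
      at \<open>y = \<phi> g\<close>, and the function of \<open>h\<close> is 1.\<close>
    have "?f \<in> T"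
    proof (rule TI[of "[(\<lambda>g y. l (\<phi> g) - l y, \<lambda>_. 1)]"])
      fix g h assume "g \<in> G" "h \<in> G"
      then show "?f (g, h) = (\<Sum>(c, b)\<leftarrow>[(\<lambda>g y. l (\<phi> g) - l y, \<lambda>_. 1)]. c g (\<psi> h) * b h)"
        using p(2) q(2) by simp
    qed (use poly_functions_diff[OF poly_functions.const poly_functions.linear[OF l]] in auto)
    then have "?f \<in> I" unfolding I_def using g0(2)[OF p(1)] h0(2)[OF q(1)] by (intro IntI fun_algebra_diff)
    then have "\<theta> ?f = 0" by (rule \<theta>(2))
    then show ?thesis
      using fun_hom_diff[OF \<theta>(1) g0(2)[OF p(1), of k] h0(2)[OF q(1), of m]] g0(3)[OF p(1), of k] h0(3)[OF q(1), of m]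
        p(2)[OF g0(1)] q(2)[OF h0(1)] by simp
  qed
  note x = linear_coordinates_basis[OF fd]
  have "\<phi> g0 = (\<Sum>b\<in>B. s (module.representation s B (\<phi> g0) b) b)"
    using x unfolding linear_coordinates_def by blast
  also have "\<dots> = (\<Sum>b\<in>B. s (module.representation s B (\<psi> h0) b) b)"
    using x eq unfolding linear_coordinates_def by (intro sum.cong refl arg_cong2[of _ _ _ _ s]) blast+
  also have "\<dots> = \<psi> h0" using x unfolding linear_coordinates_def by metis
  finally show ?thesis using that g0(1) h0(1) by blast
qed

section \<open>Existence of closed orbits in orbit closures\<close>

lemma group_GL: "group (GL :: (complex^'n^'n) monoid)"
proof (rule groupI)
  fix A :: "complex^'n^'n" assume "A \<in> carrier GL"
  then have "invertible A" by (simp add: GL_def)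
  then obtain A' where A': "A ** A' = mat 1" "A' ** A = mat 1" by (auto simp: invertible_def)
  then have "invertible A'" by (auto simp: invertible_def)
  then show "\<exists>y\<in>carrier GL. y \<otimes>\<^bsub>GL\<^esub> A = \<one>\<^bsub>GL\<^esub>" using A' by (auto simp: GL_def)
next
  show "\<one>\<^bsub>GL\<^esub> \<in> carrier (GL :: (complex^'n^'n) monoid)"
    unfolding GL_def invertible_def by (auto intro: exI[of _ "mat 1"])
qed (auto simp: GL_def invertible_mult matrix_mul_assoc)

text \<open>Invariants agree at \<open>v\<close> and \<open>w\<close> thanks to the second
  conclusion, which places \<open>w\<close> in the Zariski closure of the orbit of \<open>v\<close>.
  It comes from starting Zorn's lemma at the vanishing ideal of that orbit.\<close>

lemma closed_orbit_exists:
  fixes G :: "(complex^'n^'n) set"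
  assumes fd: "finite_dimensional_vector_space s B" and G: "linear_algebraic_group G"
    and \<rho>: "rational_representation G s \<rho>"
  obtains w where "closedin (zariski s) (orbit_of G \<rho> w)"
    "\<And>f. f \<in> poly_functions s \<Longrightarrow> (\<And>g. g \<in> G \<Longrightarrow> f (\<rho> g v) = 0) \<Longrightarrow> f w = 0"
proof -
  note x = linear_coordinates_basis[OF fd]
  let ?x = "\<lambda>b v. module.representation s B v b"
  let ?A = "poly_functions s"
  have A: "?A = fun_algebra (?x ` B)" by (rule poly_functions_eq_fun_algebra[OF x])
  have "finite B" using x by (simp add: linear_coordinates_def)
  have subG: "subgroup G GL" using G by (simp add: linear_algebraic_group_def)
  have oneG: "mat 1 \<in> G" using subgroup.one_closed[OF subG] by (simp add: GL_def)
  have multG: "g ** h \<in> G" if "g \<in> G" "h \<in> G" for g h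
    using subgroup.m_closed[OF subG that] by (simp add: GL_def)
  have \<rho>1: "\<rho> (mat 1) u = u" for u using \<rho> by (simp add: rational_representation_def)
  have \<rho>m: "\<rho> (g ** h) u = \<rho> g (\<rho> h u)" if "g \<in> G" "h \<in> G" for g h u
    using \<rho> that by (simp add: rational_representation_def)
  have \<rho>A: "(\<lambda>y. f (\<rho> g y)) \<in> ?A" if "g \<in> G" "f \<in> ?A" for f g
    using \<rho> that by (intro poly_functions_linear_comp[of f s s "\<rho> g"]) (auto simp: rational_representation_def)
  define I where "I = (\<lambda>z. {f \<in> ?A. \<forall>g\<in>G. f (\<rho> g z) = 0})"
  define stable where "stable = (\<lambda>J::('a \<Rightarrow> complex) set. \<forall>f\<in>J. \<forall>g\<in>G. (\<lambda>y. f (\<rho> g y)) \<in> J)"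
  have ideal: "fun_ideal ?A (I z)" for z
    unfolding fun_ideal_def I_def
    by (auto simp: poly_functions_plus poly_functions_times)
       (use poly_functions.const[of 0 s] in \<open>simp add: zero_fun_def\<close>)
  have proper: "1 \<notin> I z" for z using oneG by (auto simp: I_def)
  have stab: "stable (I z)" for z
    unfolding stable_def I_def using \<rho>A \<rho>m[symmetric] multG by auto
  obtain M where M: "fun_ideal ?A M" "1 \<notin> M" "stable M" "I v \<subseteq> M"
      "\<And>J. fun_ideal ?A J \<Longrightarrow> 1 \<notin> J \<Longrightarrow> stable J \<Longrightarrow> M \<subseteq> J \<Longrightarrow> J = M"
  proof (rule maximal_fun_ideal_exists[OF ideal proper, of stable v])
    fix \<C> assume "subset.chain {J. fun_ideal ?A J \<and> stable J} \<C>"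
    then show "stable (\<Union>\<C>)" by (auto simp: subset_chain_def stable_def)
  qed (use stab in blast)+
  have "countable (?x ` B)" using \<open>finite B\<close> by (simp add: countable_finite)
  then obtain \<theta> where \<theta>: "fun_hom ?A \<theta>" "\<And>f. f \<in> M \<Longrightarrow> \<theta> f = 0"
    using fun_algebra_nullstellensatz[of "?x ` B" M] M(1,2) unfolding A by blast
  define w where "w = (\<Sum>b\<in>B. s (\<theta> (?x b)) b)"
  have ev: "\<theta> f = f w" if "f \<in> ?A" for f
    using fun_hom_poly_functions[OF x, of "?x ` B" \<theta> "\<lambda>y. y" f] \<theta>(1) that unfolding A w_def
    by (auto intro: fun_algebra.gen)
  have w: "f w = 0" if "f \<in> M" for f
    using \<theta>(2)[OF that] ev fun_idealD(1)[OF M(1) that] by simp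
  \<comment> \<open>By stability \<open>M\<close> vanishes on the whole orbit of \<open>z\<close>,
    so it is contained in the proper stable ideal \<open>I z\<close>; maximality gives
    equality.\<close>
  have IM: "I z = M" if "\<And>f. f \<in> M \<Longrightarrow> f z = 0" for z
  proof (rule M(5)[OF ideal proper stab])
    show "M \<subseteq> I z"
    proof
      fix f assume f: "f \<in> M"
      then have "f (\<rho> g z) = 0" if "g \<in> G" for g
        using that M(3) \<open>\<And>f. f \<in> M \<Longrightarrow> f z = 0\<close> by (auto simp: stable_def)
      then show "f \<in> I z" using fun_idealD(1)[OF M(1) f] by (simp add: I_def)
    qed
  qed
  have regular: "\<exists>p\<in>poly_functions matrix_scale. \<exists>k::nat. \<forall>g\<in>G. l (\<rho> g z) = p g / det g ^ k"
    if "Vector_Spaces.linear s (*) l" for l z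
    using \<rho> that unfolding rational_representation_def by blast
  have "orbit_of G \<rho> w = (\<Inter>f\<in>M. {y. f y = 0})"
  proof (intro equalityI subsetI)
    fix y assume "y \<in> orbit_of G \<rho> w"
    then obtain g where "g \<in> G" "y = \<rho> g w" by (auto simp: orbit_of_def)
    then show "y \<in> (\<Inter>f\<in>M. {y. f y = 0})" using M(3) w by (auto simp: stable_def)
  next
    fix y assume y: "y \<in> (\<Inter>f\<in>M. {y. f y = 0})"
    have "I w = I y" using IM[of w] IM[of y] w y by auto
    then have "(\<forall>g\<in>G. p (\<rho> g w) = 0) \<longleftrightarrow> (\<forall>h\<in>G. p (\<rho> h y) = 0)" if "p \<in> ?A" for p
      using that unfolding I_def by blast
    then obtain g h where gh: "g \<in> G" "h \<in> G" "\<rho> g w = \<rho> h y"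
      using dense_images_meet[where \<phi> = "\<lambda>g. \<rho> g w" and \<psi> = "\<lambda>g. \<rho> g y", OF fd G regular regular]
      by blast
    define k where "k = inv\<^bsub>GL\<^esub> h"
    have k: "k \<in> G" "k ** h = mat 1"
      using subgroup.m_inv_closed[OF subG gh(2)] group.l_inv[OF group_GL subgroup.mem_carrier[OF subG gh(2)]]
      unfolding k_def by (simp_all add: GL_def)
    have "y = \<rho> (k ** g) w" using gh k \<rho>m[OF k(1)] \<rho>1 by metis
    then show "y \<in> orbit_of G \<rho> w" using multG[OF k(1) gh(1)] by (auto simp: orbit_of_def)
  qed
  moreover have "closedin (zariski s) (\<Inter>f\<in>M. {y. f y = 0})"
    using fun_idealD(1,2)[OF M(1)] closedin_zariski_zeros by (intro closedin_INT) auto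
  moreover have "f w = 0" if "f \<in> ?A" "\<And>g. g \<in> G \<Longrightarrow> f (\<rho> g v) = 0" for f
    using that M(4) w by (auto simp: I_def)
  ultimately show ?thesis using that by metis
qed

section \<open>Generic equality on irreducible sets\<close>

lemma poly_functions_on_line:
  assumes "vector_space s" "p \<in> poly_functions s"
  obtains P where "\<And>t. p (x + s t y) = poly P t"
proof -
  have "\<exists>P. \<forall>t. p (x + s t y) = poly P t"
    using assms(2)
  proof induction
    case (linear l)
    interpret l: Vector_Spaces.linear s "(*)" l by fact
    show ?case by (rule exI[of _ "[:l x, l y:]"]) (simp add: l.add l.scale)
  next
    case (const c)
    show ?case by (rule exI[of _ "[:c:]"]) simp
  next
    case (add p q)
    then obtain P Q where "\<forall>t. p (x + s t y) = poly P t" "\<forall>t. q (x + s t y) = poly Q t" by auto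
    then show ?case by (intro exI[of _ "P + Q"]) simp
  next
    case (mult p q)
    then obtain P Q where "\<forall>t. p (x + s t y) = poly P t" "\<forall>t. q (x + s t y) = poly Q t" by auto
    then show ?case by (intro exI[of _ "P * Q"]) simp
  qed
  then show ?thesis using that by blast
qed

text \<open>On the line through \<open>a\<close> and \<open>b\<close>, with parameters 0 and 1
  there, both functions become nonzero univariate polynomials, and their product has a nonzero
  value.\<close>

lemma poly_functions_no_zero_divisors:
  assumes "vector_space s" "p \<in> poly_functions s" "q \<in> poly_functions s" "p a \<noteq> 0" "q b \<noteq> 0"
  obtains x where "p x * q x \<noteq> 0"
proof -
  interpret vector_space s by fact
  obtain P where P: "\<And>t. p (a + s t (b - a)) = poly P t"
    using poly_functions_on_line[OF assms(1,2)] by blast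
  obtain Q where Q: "\<And>t. q (a + s t (b - a)) = poly Q t"
    using poly_functions_on_line[OF assms(1,3)] by blast
  have "poly P 0 \<noteq> 0" "poly Q 1 \<noteq> 0" using P[of 0] Q[of 1] assms(4,5) by auto
  then have "P * Q \<noteq> 0" by auto
  then obtain t where "poly (P * Q) t \<noteq> 0" using poly_all_0_iff_0 by blast
  then show ?thesis using that[of "a + s t (b - a)"] P Q by simp
qed

lemma irreduciblein_UNIV:
  assumes "vector_space s"
  shows "irreduciblein (zariski s) UNIV"
  unfolding irreduciblein_def
proof (intro conjI allI impI)
  fix A B assume AB: "closedin (zariski s) A \<and> closedin (zariski s) B \<and> UNIV \<subseteq> A \<union> B"
  show "UNIV \<subseteq> A \<or> UNIV \<subseteq> B"
  proof (rule ccontr)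
    assume "\<not> ?thesis"
    then obtain a b where ab: "a \<notin> A" "b \<notin> B" by blast
    obtain p where p: "p \<in> poly_functions s" "p a \<noteq> 0" "\<And>y. y \<in> A \<Longrightarrow> p y = 0"
      using closedin_zariski_separate[OF _ ab(1)] AB by blast
    obtain q where q: "q \<in> poly_functions s" "q b \<noteq> 0" "\<And>y. y \<in> B \<Longrightarrow> q y = 0"
      using closedin_zariski_separate[OF _ ab(2)] AB by blast
    obtain x where "p x * q x \<noteq> 0"
      using poly_functions_no_zero_divisors[OF assms p(1) q(1) p(2) q(2)] by blast
    then show False using p(3) q(3) AB by auto
  qed
qed auto

lemma generically_mono:
  assumes "generically s Y P" "\<And>y. y \<in> Y \<Longrightarrow> P y \<Longrightarrow> Q y"
  shows "generically s Y Q"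
proof -
  obtain U where U: "openin (subtopology (zariski s) Y) U" "U \<noteq> {}" "\<forall>y\<in>U. P y"
    using assms(1) by (auto simp: generically_def)
  have "U \<subseteq> Y" using openin_subset[OF U(1)] by simp
  then show ?thesis using U assms(2) unfolding generically_def by blast
qed

context
  fixes s :: "complex \<Rightarrow> 'v::ab_group_add \<Rightarrow> 'v" and Y
  assumes irr: "irreduciblein (zariski s) Y"
begin

lemma generically_everywhere: "(\<And>y. y \<in> Y \<Longrightarrow> P y) \<Longrightarrow> generically s Y P"
  using irr unfolding generically_def irreduciblein_def
  by (intro exI[of _ Y]) (auto simp: openin_subtopology intro!: exI[of _ UNIV] openin_topspace[of "zariski s", simplified])

text \<open>Irreducibility enters here: the complements of two open sets that meet \<open>Y\<close>
  cannot together cover \<open>Y\<close>.\<close>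

lemma generically_conj:
  assumes "generically s Y P" "generically s Y Q"
  shows "generically s Y (\<lambda>y. P y \<and> Q y)"
proof -
  obtain U where U: "openin (zariski s) U" "U \<inter> Y \<noteq> {}" "\<forall>y\<in>U \<inter> Y. P y"
    using assms(1) by (auto simp: generically_def openin_subtopology)
  obtain V where V: "openin (zariski s) V" "V \<inter> Y \<noteq> {}" "\<forall>y\<in>V \<inter> Y. Q y"
    using assms(2) by (auto simp: generically_def openin_subtopology)
  have "closedin (zariski s) (UNIV - U)" "closedin (zariski s) (UNIV - V)"
    using closedin_diff[OF closedin_topspace[of "zariski s"]] U(1) V(1) by auto
  then have "\<not> Y \<subseteq> (UNIV - U) \<union> (UNIV - V)"
    using irr U(2) V(2) unfolding irreduciblein_def by blast
  then have "U \<inter> V \<inter> Y \<noteq> {}" by auto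
  moreover have "openin (subtopology (zariski s) Y) (U \<inter> V \<inter> Y)"
    using U(1) V(1) by (auto simp: openin_subtopology)
  ultimately show ?thesis
    using U(3) V(3) unfolding generically_def by (intro exI[of _ "U \<inter> V \<inter> Y"]) auto
qed

lemma generically_nonzero:
  assumes "p \<in> poly_functions s" "y \<in> Y" "p y \<noteq> 0"
  shows "generically s Y (\<lambda>y. p y \<noteq> 0)"
  unfolding generically_def
proof (intro exI[of _ "{x. p x \<noteq> 0} \<inter> Y"] conjI)
  show "openin (subtopology (zariski s) Y) ({x. p x \<noteq> 0} \<inter> Y)"
    using openin_zariski_nonzero[OF assms(1)] by (auto simp: openin_subtopology)
qed (use assms in auto)

lemma generically_zero:
  assumes "p \<in> poly_functions s" "generically s Y (\<lambda>y. p y = 0)" "y \<in> Y"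
  shows "p y = 0"
proof (rule ccontr)
  assume "p y \<noteq> 0"
  then have "generically s Y (\<lambda>y. p y = 0 \<and> p y \<noteq> 0)"
    using assms by (intro generically_conj generically_nonzero)
  then show False by (auto simp: generically_def)
qed

lemma generically_eq_imp_eq:
  assumes "p \<in> poly_functions s" "q \<in> poly_functions s" "generically s Y (\<lambda>y. p y = q y)" "y \<in> Y"
  shows "p y = q y"
proof -
  have "generically s Y (\<lambda>y. p y - q y = 0)" using assms(3) by (rule generically_mono) simp
  from generically_zero[OF poly_functions_diff[OF assms(1,2)] this assms(4)] show ?thesis by simp
qed

text \<open>The factor \<open>r\<close> is generically nonzero, and polynomials that agree
  generically agree on all of \<open>Y\<close>.\<close>

lemma poly_functions_cancel_on:
  assumes "p \<in> poly_functions s" "q \<in> poly_functions s" "r \<in> poly_functions s" "\<exists>y\<in>Y. r y \<noteq> 0"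
    and "\<And>y. y \<in> Y \<Longrightarrow> p y * r y = q y * r y" "y \<in> Y"
  shows "p y = q y"
proof (rule generically_eq_imp_eq[OF assms(1,2) _ assms(6)])
  have "generically s Y (\<lambda>y. r y \<noteq> 0)" using assms(3,4) generically_nonzero by blast
  then show "generically s Y (\<lambda>y. p y = q y)" by (rule generically_mono) (use assms(5) in auto)
qed

section \<open>Germs, fractions and regular automorphisms\<close>

lemma germ_refl: "f \<in> germ s Y f"
  unfolding germ_def using generically_everywhere[of "\<lambda>_. True"] by simp

lemma germ_eq_iff: "germ s Y f = germ s Y g \<longleftrightarrow> generically s Y (\<lambda>y. f y = g y)"
proof
  assume "germ s Y f = germ s Y g"
  then have "f \<in> germ s Y g" using germ_refl[of f] by simp
  then show "generically s Y (\<lambda>y. f y = g y)" by (simp add: germ_def)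
next
  assume fg: "generically s Y (\<lambda>y. f y = g y)"
  have "generically s Y (\<lambda>y. k y = f y) \<longleftrightarrow> generically s Y (\<lambda>y. k y = g y)" for k
  proof
    assume "generically s Y (\<lambda>y. k y = f y)"
    from generically_conj[OF this fg] show "generically s Y (\<lambda>y. k y = g y)"
      by (rule generically_mono) auto
  next
    assume "generically s Y (\<lambda>y. k y = g y)"
    from generically_conj[OF this fg] show "generically s Y (\<lambda>y. k y = f y)"
      by (rule generically_mono) auto
  qed
  then show "germ s Y f = germ s Y g" by (simp add: germ_def)
qed

lemma germ_eq: "g \<in> germ s Y f \<Longrightarrow> germ s Y g = germ s Y f"
  by (simp add: germ_eq_iff) (simp add: germ_def)

text \<open>Quotients take the value 0 where a denominator vanishes, so cross-multiplication is
  restricted to the generic locus where both denominators are nonzero; the polynomial identity found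
  there spreads to all of \<open>Y\<close>.\<close>

lemma germ_fraction_eq_iff:
  assumes "a \<in> poly_functions s" "b \<in> poly_functions s" "\<exists>y\<in>Y. b y \<noteq> 0"
    and "c \<in> poly_functions s" "d \<in> poly_functions s" "\<exists>y\<in>Y. d y \<noteq> 0"
  shows "germ s Y (\<lambda>y. a y / b y) = germ s Y (\<lambda>y. c y / d y) \<longleftrightarrow> (\<forall>y\<in>Y. a y * d y = c y * b y)"
proof -
  have nz: "generically s Y (\<lambda>y. b y \<noteq> 0 \<and> d y \<noteq> 0)"
    using assms generically_nonzero by (intro generically_conj) blast+
  show ?thesis
    unfolding germ_eq_iff
  proof
    assume "generically s Y (\<lambda>y. a y / b y = c y / d y)"
    from generically_conj[OF this nz] have "generically s Y (\<lambda>y. a y * d y = c y * b y)"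
      by (rule generically_mono) (auto simp: field_simps)
    then show "\<forall>y\<in>Y. a y * d y = c y * b y"
      using generically_eq_imp_eq[OF poly_functions.mult[OF assms(1,5)] poly_functions.mult[OF assms(4,2)]] by auto
  next
    assume eq: "\<forall>y\<in>Y. a y * d y = c y * b y"
    show "generically s Y (\<lambda>y. a y / b y = c y / d y)"
      using nz by (rule generically_mono) (use eq in \<open>auto simp: field_simps\<close>)
  qed
qed

text \<open>The preimage of a basic open set is open because \<open>p \<circ> \<phi>\<close> is
  polynomial on \<open>Y\<close>, and it is nonempty because \<phi> has an inverse.\<close>

lemma generically_regular_automorphism:
  assumes "regular_automorphism s Y \<phi>" "generically s Y P"
  shows "generically s Y (\<lambda>y. P (\<phi> y))"
proof -
  obtain U where U: "openin (zariski s) U" "U \<inter> Y \<noteq> {}" "\<forall>y\<in>U \<inter> Y. P y"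
    using assms(2) by (auto simp: generically_def openin_subtopology)
  then obtain y0 where y0: "y0 \<in> U" "y0 \<in> Y" by auto
  obtain p where p: "p \<in> poly_functions s" "p y0 \<noteq> 0" "\<And>y. p y \<noteq> 0 \<Longrightarrow> y \<in> U"
    using openin_zariski_basis[OF U(1) y0(1)] by blast
  obtain \<psi> where \<psi>: "\<psi> y0 \<in> Y" "\<phi> (\<psi> y0) = y0"
    using assms(1) y0(2) unfolding regular_automorphism_def regular_map_def by blast
  have \<phi>: "\<And>y. y \<in> Y \<Longrightarrow> \<phi> y \<in> Y" "restrict (p \<circ> \<phi>) Y \<in> carrier (coordinate_ring s Y)"
    using assms(1) p(1) unfolding regular_automorphism_def regular_map_def by auto
  then obtain q where q: "q \<in> poly_functions s" "restrict (p \<circ> \<phi>) Y = restrict q Y"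
    by (auto simp: coordinate_ring_def)
  have pq: "p (\<phi> y) = q y" if "y \<in> Y" for y
    using fun_cong[OF q(2), of y] that by simp
  have "generically s Y (\<lambda>y. q y \<noteq> 0)"
    using generically_nonzero[OF q(1) \<psi>(1)] pq[OF \<psi>(1)] \<psi>(2) p(2) by simp
  then show ?thesis by (rule generically_mono) (use pq \<phi>(1) p(3) U(3) in force)
qed

text \<open>Generic equality of representatives survives composition with \<phi>, so all sets in the
  union coincide.\<close>

lemma pullback_germ:
  assumes "regular_automorphism s Y \<phi>"
  shows "pullback s Y \<phi> (germ s Y f) = germ s Y (f \<circ> \<phi>)"
proof -
  have "germ s Y (g \<circ> \<phi>) = germ s Y (f \<circ> \<phi>)" if "g \<in> germ s Y f" for g
    using generically_regular_automorphism[OF assms, of "\<lambda>y. g y = f y"] that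
    by (simp add: germ_eq_iff) (simp add: germ_def)
  then show ?thesis unfolding pullback_def using germ_refl by blast
qed

text \<open>For a regular action \<open>h\<close> and its translates are all restrictions of
  polynomials, and for these generic equality is equality everywhere.\<close>

lemma regular_rational_invariants_eq:
  assumes "faithful_regular_action s Y W \<alpha>"
  shows "regular_rational_invariants s Y (carrier W) \<alpha> = regular_invariants s Y (carrier W) \<alpha>"
proof -
  have "germ s Y h \<in> carrier (rational_invariants s Y (carrier W) \<alpha>) \<longleftrightarrow>
      (\<forall>w\<in>carrier W. \<forall>y\<in>Y. h (\<alpha> w y) = h y)" if h: "h \<in> carrier (coordinate_ring s Y)" for h
  proof -
    obtain H where H: "H \<in> poly_functions s" "h = restrict H Y"
      using h by (auto simp: coordinate_ring_def)
    have "germ s Y h = germ s Y (\<lambda>y. H y / 1)"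
      unfolding germ_eq_iff by (rule generically_everywhere) (simp add: H)
    moreover have "\<exists>y. y \<in> Y" using irr by (auto simp: irreduciblein_def)
    ultimately have ff: "germ s Y h \<in> carrier (function_field s Y)"
      unfolding function_field_def using H(1) poly_functions.const[of 1 s]
      by (simp, intro exI[of _ H] exI[of _ "\<lambda>_. 1"]) simp
    have "pullback s Y (\<alpha> w) (germ s Y h) = germ s Y h \<longleftrightarrow> (\<forall>y\<in>Y. h (\<alpha> w y) = h y)"
      if w: "w \<in> carrier W" for w
    proof -
      have aut: "regular_automorphism s Y (\<alpha> w)"
        using assms w by (simp add: faithful_regular_action_def)
      then have Y: "\<And>y. y \<in> Y \<Longrightarrow> \<alpha> w y \<in> Y" and
        "restrict (H \<circ> \<alpha> w) Y \<in> carrier (coordinate_ring s Y)"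
        using H(1) by (auto simp: regular_automorphism_def regular_map_def)
      then obtain q where q: "q \<in> poly_functions s" "restrict (H \<circ> \<alpha> w) Y = restrict q Y"
        by (auto simp: coordinate_ring_def)
      have hq: "h (\<alpha> w y) = q y" if "y \<in> Y" for y
        using fun_cong[OF q(2), of y] that Y H(2) by simp
      show ?thesis
        unfolding pullback_germ[OF aut] germ_eq_iff
      proof
        assume "generically s Y (\<lambda>y. (h \<circ> \<alpha> w) y = h y)"
        then have "generically s Y (\<lambda>y. q y = H y)"
          by (rule generically_mono) (use hq H(2) in auto)
        then show "\<forall>y\<in>Y. h (\<alpha> w y) = h y"
          using generically_eq_imp_eq[OF q(1) H(1)] hq H(2) by auto
      next
        assume "\<forall>y\<in>Y. h (\<alpha> w y) = h y"
        then show "generically s Y (\<lambda>y. (h \<circ> \<alpha> w) y = h y)" by (intro generically_everywhere) simp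
      qed
    qed
    then show ?thesis using ff by (simp add: rational_invariants_def)
  qed
  then show ?thesis unfolding regular_rational_invariants_def regular_invariants_def
    by (intro arg_cong[where f = "\<lambda>C. coordinate_ring s Y\<lparr>carrier := C\<rparr>"]) blast
qed

end

section \<open>Divisibility of invariants\<close>

lemma restrict_UNIV: "restrict f UNIV = f"
  by (simp add: restrict_def)

lemma carrier_regular_invariants_UNIV:
  "carrier (regular_invariants s UNIV G \<rho>) = {f \<in> poly_functions s. \<forall>g\<in>G. \<forall>x. f (\<rho> g x) = f x}"
  by (auto simp: regular_invariants_def coordinate_ring_def restrict_UNIV)

lemma regular_invariants_simps:
  "f \<otimes>\<^bsub>regular_invariants s Y G \<rho>\<^esub> g = (\<lambda>y\<in>Y. f y * g y)"
  "f \<oplus>\<^bsub>regular_invariants s Y G \<rho>\<^esub> g = (\<lambda>y\<in>Y. f y + g y)"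
  "\<one>\<^bsub>regular_invariants s Y G \<rho>\<^esub> = (\<lambda>y\<in>Y. 1)"
  "\<zero>\<^bsub>regular_invariants s Y G \<rho>\<^esub> = (\<lambda>y\<in>Y. 0)"
  by (simp_all add: regular_invariants_def coordinate_ring_def)

text \<open>On the fibre of \<open>p\<close> and \<open>q\<close> through a zero of \<open>q\<close> there is a closed orbit, hence a point of \<open>Y\<close>.\<close>
lemma invariant_divides_power:
  fixes G :: "(complex^'n^'n) set"
  assumes fd: "finite_dimensional_vector_space s B" and G: "linear_algebraic_group G"
    and \<rho>: "rational_representation G s \<rho>"
    and orbits: "\<And>v. closedin (zariski s) (orbit_of G \<rho> v) \<Longrightarrow> Y \<inter> orbit_of G \<rho> v \<noteq> {}"
    and p: "p \<in> carrier (regular_invariants s UNIV G \<rho>)"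
    and q: "q \<in> carrier (regular_invariants s UNIV G \<rho>)" "q x0 \<noteq> 0"
    and eq: "\<And>y. y \<in> Y \<Longrightarrow> p y = h y * q y"
  obtains r n where "r \<in> carrier (regular_invariants s UNIV G \<rho>)" "\<And>x. p x ^ n = q x * r x"
proof -
  note [simp] = carrier_regular_invariants_UNIV
  interpret finite_dimensional_vector_space s B by fact
  have zero: "p v = 0" if "q v = 0" for v
  proof -
    obtain w where w: "closedin (zariski s) (orbit_of G \<rho> w)"
      "\<And>f. f \<in> poly_functions s \<Longrightarrow> (\<And>g. g \<in> G \<Longrightarrow> f (\<rho> g v) = 0) \<Longrightarrow> f w = 0"
      using closed_orbit_exists[OF fd G \<rho>] by blast
    obtain g where g: "g \<in> G" "\<rho> g w \<in> Y" using orbits[OF w(1)] by (auto simp: orbit_of_def)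
    have "q w = 0" using w(2)[of q] q that by simp
    then have "p w = 0" using eq[OF g(2)] g(1) p q by simp
    \<comment> \<open>By invariance \<open>p - p v\<close> vanishes along the orbit of
      \<open>v\<close>, whose closure contains \<open>w\<close>.\<close>
    moreover have "p w - p v = 0"
      using w(2)[of "\<lambda>x. p x - p v"] p by (simp add: poly_functions_diff poly_functions.const)
    ultimately show ?thesis by simp
  qed
  obtain r n where r: "r \<in> poly_functions s" "\<And>x. p x ^ n = q x * r x"
    by (rule poly_functions_nullstellensatz[OF fd _ _ zero]) (use p q in auto)
  \<comment> \<open>The quotient must be invariant for divisibility among invariants. Invariance of
    \<open>p\<close> and \<open>q\<close> makes \<open>q\<close> times
    \<open>r \<circ> \<rho> g - r\<close> vanish, and \<open>q\<close> is not a zero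
    divisor.\<close>
  have "r (\<rho> g x) = r x" if g: "g \<in> G" for g x
  proof (rule ccontr)
    assume "r (\<rho> g x) \<noteq> r x"
    moreover have "(\<lambda>x. r (\<rho> g x)) \<in> poly_functions s"
      using \<rho> g r(1) by (intro poly_functions_linear_comp[of r s s "\<rho> g"]) (auto simp: rational_representation_def)
    then have "(\<lambda>x. r (\<rho> g x) - r x) \<in> poly_functions s" using r(1) by (rule poly_functions_diff)
    ultimately obtain z where "q z * (r (\<rho> g z) - r z) \<noteq> 0"
      using poly_functions_no_zero_divisors[OF vector_space_axioms, of q "\<lambda>x. r (\<rho> g x) - r x" x0 x] q
      by auto
    moreover have "q z * r (\<rho> g z) = q z * r z" using r(2)[of z] r(2)[of "\<rho> g z"] p q g by auto
    ultimately show False by (simp add: algebra_simps)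
  qed
  then show ?thesis using r by (intro that[of r n]) auto
qed

text \<open>That \<open>q\<close> divides a power of \<open>p\<close> tells which primes divide
  \<open>p\<close>, not how often. So the induction over the irreducible factors of \<open>q\<close>
  keeps the relation \<open>p = h q\<close> on \<open>Y\<close>: by \<open>nz\<close> a cancelled
  factor is not identically zero on \<open>Y\<close>, the relation passes to the quotients, and the
  power argument applies afresh.\<close>

lemma invariant_divides:
  fixes G :: "(complex^'n^'n) set"
  assumes fd: "finite_dimensional_vector_space s B" and G: "linear_algebraic_group G"
    and \<rho>: "rational_representation G s \<rho>"
    and ufd: "factorial_domain (regular_invariants s UNIV G \<rho>)"
    and irr: "irreduciblein (zariski s) Y"
    and orbits: "\<And>v. closedin (zariski s) (orbit_of G \<rho> v) \<Longrightarrow> Y \<inter> orbit_of G \<rho> v \<noteq> {}"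
    and nz: "\<And>f x. f \<in> carrier (regular_invariants s UNIV G \<rho>) \<Longrightarrow> f x \<noteq> 0 \<Longrightarrow> \<exists>y\<in>Y. f y \<noteq> 0"
    and p: "p \<in> carrier (regular_invariants s UNIV G \<rho>)"
    and q: "q \<in> carrier (regular_invariants s UNIV G \<rho>)" "q x0 \<noteq> 0"
    and h: "h \<in> poly_functions s" "\<And>y. y \<in> Y \<Longrightarrow> p y = h y * q y"
  obtains r where "r \<in> carrier (regular_invariants s UNIV G \<rho>)" "\<And>x. p x = r x * q x"
proof -
  define R where "R = regular_invariants s UNIV G \<rho>"
  interpret factorial_domain R unfolding R_def by (rule ufd)
  have mult: "f \<otimes>\<^bsub>R\<^esub> g = (\<lambda>x. f x * g x)" and one: "\<one>\<^bsub>R\<^esub> = (\<lambda>_. 1)" and zero: "\<zero>\<^bsub>R\<^esub> = (\<lambda>_. 0)" for f g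
    by (simp_all add: R_def regular_invariants_simps restrict_UNIV)
  have carrier: "f \<in> carrier R \<Longrightarrow> f \<in> poly_functions s" for f
    by (simp add: R_def carrier_regular_invariants_UNIV)
  have nonzero: "f \<noteq> \<zero>\<^bsub>R\<^esub> \<longleftrightarrow> (\<exists>x. f x \<noteq> 0)" for f by (auto simp: zero)
  have main: "\<exists>r\<in>carrier R. p = r \<otimes>\<^bsub>R\<^esub> q"
    if "set fs \<subseteq> carrier (mult_of R)" "\<forall>f\<in>set fs. irreducible (mult_of R) f" "q = foldr (\<otimes>\<^bsub>R\<^esub>) fs \<one>\<^bsub>R\<^esub>"
      "p \<in> carrier R" "\<And>y. y \<in> Y \<Longrightarrow> p y = h y * q y" for fs p q
    using that
  proof (induction fs arbitrary: p q)
    case Nil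
    then show ?case by (intro bexI[of _ p]) auto
  next
    case (Cons f fs)
    let ?q = "foldr (\<otimes>\<^bsub>R\<^esub>) fs \<one>\<^bsub>R\<^esub>"
    have q': "?q \<in> carrier (mult_of R)"
      using mult_of.multlist_closed[of fs] Cons.prems(1) by simp
    have f: "f \<in> carrier (mult_of R)" "f \<in> carrier R" using Cons.prems(1) by auto
    have q: "q = f \<otimes>\<^bsub>R\<^esub> ?q" using Cons.prems(3) by simp
    have "prime (mult_of R) f" using Cons.prems(2) f by (intro irreducible_prime) auto
    then have prime: "\<not> f divides\<^bsub>mult_of R\<^esub> \<one>\<^bsub>R\<^esub>"
      "\<And>a b. a \<in> carrier (mult_of R) \<Longrightarrow> b \<in> carrier (mult_of R) \<Longrightarrow>
        f divides\<^bsub>mult_of R\<^esub> (a \<otimes>\<^bsub>R\<^esub> b) \<Longrightarrow> f divides\<^bsub>mult_of R\<^esub> a \<or> f divides\<^bsub>mult_of R\<^esub> b"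
      using mult_of.divides_unit[OF _ f(1) mult_of.Units_one_closed] by (auto simp: prime_def)
    \<comment> \<open>Divisibility takes place in the monoid \<open>mult_of R\<close> of nonzero
      elements, hence the separate case of a zero \<open>p\<close>.\<close>
    show ?case
    proof (cases "p = \<zero>\<^bsub>R\<^esub>")
      case True
      then show ?thesis using q' f by (intro bexI[of _ "\<zero>\<^bsub>R\<^esub>"]) (auto simp: q)
    next
      case False
      have qR: "q \<in> carrier (mult_of R)" using q q' f by (auto simp: integral_iff)
      then obtain x where "q x \<noteq> 0" using nonzero by auto
      then obtain r n where r: "r \<in> carrier R" "\<And>x. p x ^ n = q x * r x"
        using invariant_divides_power[OF fd G \<rho> orbits, of p q x h] Cons.prems(4,5) qR
        unfolding R_def[symmetric] by auto
      have pow: "p [^]\<^bsub>R\<^esub> m = (\<lambda>x. p x ^ m)" for m :: nat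
        by (induction m) (auto simp: one mult)
      have "p [^]\<^bsub>R\<^esub> n = f \<otimes>\<^bsub>R\<^esub> (?q \<otimes>\<^bsub>R\<^esub> r)"
        using r(2) q by (simp add: pow mult algebra_simps)
      then have "f divides\<^bsub>R\<^esub> (p [^]\<^bsub>R\<^esub> n)" using q' r(1) by (auto simp: factor_def)
      moreover have "p [^]\<^bsub>R\<^esub> m \<in> carrier (mult_of R)" for m :: nat
        using False Cons.prems(4) by (induction m) (auto simp: integral_iff)
      note powR = this
      ultimately have "f divides\<^bsub>mult_of R\<^esub> (p [^]\<^bsub>R\<^esub> n)"
        using divides_imp_divides_mult[OF f(2)] by auto
      then have "f divides\<^bsub>mult_of R\<^esub> p"
      proof (induction n)
        case 0 then show ?case using prime(1) by simp
      next
        case (Suc n)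
        then show ?case using prime(2)[OF powR, of p n] False Cons.prems(4) by auto
      qed
      then obtain p' where p': "p' \<in> carrier R" "p = f \<otimes>\<^bsub>R\<^esub> p'" by (auto simp: factor_def)
      have "p' y = h y * ?q y" if y: "y \<in> Y" for y
      proof (rule poly_functions_cancel_on[OF irr carrier[OF p'(1)] _ carrier[OF f(2)] _ _ y])
        show "(\<lambda>y. h y * ?q y) \<in> poly_functions s" using h(1) carrier q' by (auto intro: poly_functions.mult)
        show "\<exists>y\<in>Y. f y \<noteq> 0" using nz f nonzero unfolding R_def by auto
        show "p' y * f y = h y * ?q y * f y" if "y \<in> Y" for y
          using Cons.prems(5)[OF that] unfolding q p'(2) mult by (simp add: algebra_simps)
      qed
      then obtain r where "r \<in> carrier R" "p' = r \<otimes>\<^bsub>R\<^esub> ?q"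
        using Cons.IH[of ?q p'] Cons.prems(1,2) p'(1) by auto
      then show ?thesis
        using q' f unfolding p'(2) q by (intro bexI[of _ r]) (auto simp: mult algebra_simps)
    qed
  qed
  have qR: "q \<in> carrier (mult_of R)" using q nonzero unfolding R_def by auto
  \<comment> \<open>\<open>factors_exist\<close> concerns nonunits; a unit divides
    everything.\<close>
  have "\<exists>r\<in>carrier R. p = r \<otimes>\<^bsub>R\<^esub> q"
  proof (cases "q \<in> Units (mult_of R)")
    case True
    then obtain u where u: "u \<in> carrier R" "u \<otimes>\<^bsub>R\<^esub> q = \<one>\<^bsub>R\<^esub>" by (auto simp: Units_def)
    then show ?thesis using p qR unfolding R_def[symmetric]
      by (intro bexI[of _ "p \<otimes>\<^bsub>R\<^esub> u"]) (auto simp: m_assoc)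
  next
    case False
    then obtain fs where "set fs \<subseteq> carrier (mult_of R)" "factors (mult_of R) fs q"
      using factors_exist[OF qR] by auto
    then show ?thesis using main[of fs q p] p h(2) unfolding R_def[symmetric] by (auto simp: factors_def)
  qed
  then show ?thesis using that unfolding mult by (auto simp: R_def)
qed

section \<open>The restriction isomorphism\<close>

text \<open>A nonzero invariant cannot vanish on \<open>Y\<close>, as its inverse could not be restricted to \<open>Y\<close>.\<close>
lemma galois_restriction_nonzero:
  assumes vs: "vector_space s"
    and frac: "carrier (rational_invariants s UNIV G \<rho>) = invariant_fractions s G \<rho>"
    and gal: "galois_restriction_property s G \<rho> Y W \<alpha>"
    and f: "f \<in> carrier (regular_invariants s UNIV G \<rho>)" "f x \<noteq> 0"
  shows "\<exists>y\<in>Y. f y \<noteq> 0"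
proof -
  note irrV = irreduciblein_UNIV[OF vs]
  have fp: "f \<in> poly_functions s" and "(\<lambda>_. 1) \<in> carrier (regular_invariants s UNIV G \<rho>)"
    using f by (simp_all add: carrier_regular_invariants_UNIV poly_functions.const)
  then have "germ s UNIV (\<lambda>x. 1 / f x) \<in> carrier (rational_invariants s UNIV G \<rho>)"
    using f unfolding frac invariant_fractions_def
    by (intro CollectI exI[of _ "\<lambda>_. 1"] exI[of _ f]) auto
  then obtain a b y where ab: "a \<in> poly_functions s" "b \<in> poly_functions s" "y \<in> Y" "b y \<noteq> 0"
    "(\<lambda>x. a x / b x) \<in> germ s UNIV (\<lambda>x. 1 / f x)"
    using gal unfolding galois_restriction_property_def restrictable_def by blast
  have "\<forall>y\<in>UNIV. a y * f y = 1 * b y"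
    using germ_fraction_eq_iff[OF irrV ab(1,2) _ poly_functions.const[of 1] fp] germ_eq[OF irrV ab(5)] ab(4) f(2)
    by blast
  then have "a y * f y = b y" by simp
  then show ?thesis using ab(3,4) by (intro bexI[of _ y]) auto
qed

text \<open>Equality of two fractions on the whole space is a cross-multiplied identity, which holds
  in particular on \<open>Y\<close>; hence the union defining the restriction is over a single
  germ.\<close>

lemma rational_restriction_fraction:
  assumes vs: "vector_space s" and irr: "irreduciblein (zariski s) Y"
    and "p \<in> poly_functions s" "q \<in> poly_functions s" "y0 \<in> Y" "q y0 \<noteq> 0"
  shows "rational_restriction s Y (germ s UNIV (\<lambda>x. p x / q x)) = germ s Y (\<lambda>x. p x / q x)"
proof -
  note irrV = irreduciblein_UNIV[OF vs]
  have "germ s Y (\<lambda>x. a x / b x) = germ s Y (\<lambda>x. p x / q x)"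
    if "a \<in> poly_functions s" "b \<in> poly_functions s" "\<exists>y\<in>Y. b y \<noteq> 0"
      "(\<lambda>x. a x / b x) \<in> germ s UNIV (\<lambda>x. p x / q x)" for a b
  proof -
    have "\<forall>y\<in>UNIV. a y * q y = p y * b y"
      using germ_fraction_eq_iff[OF irrV that(1,2) _ assms(3,4)] germ_eq[OF irrV that(4)] that(3) assms(6)
      by blast
    then show ?thesis
      using germ_fraction_eq_iff[OF irr that(1,2,3) assms(3,4)] assms(5,6) by blast
  qed
  moreover have "(\<lambda>x. p x / q x) \<in> germ s UNIV (\<lambda>x. p x / q x)" by (rule germ_refl[OF irrV])
  ultimately show ?thesis using assms(3-6) unfolding rational_restriction_def by blast
qed

text \<open>The Galois property makes \<open>W\<close> act by birational maps only, so invariance of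
  a regular function is first read in the function field. The isomorphism onto the regular functions
  invariant in this sense becomes the Chevalley property as soon as the operators form a regular
  action.\<close>

theorem corollary2:
  fixes s :: "complex \<Rightarrow> 'v::ab_group_add \<Rightarrow> 'v" and B :: "'v set"
    and G :: "(complex^'n^'n) set" and \<rho> :: "complex^'n^'n \<Rightarrow> 'v \<Rightarrow> 'v"
    and Y :: "'v set" and W :: "('w, 'm) monoid_scheme" and \<alpha> :: "'w \<Rightarrow> 'v \<Rightarrow> 'v"
  assumes "finite_dimensional_vector_space s B"
    and "reductive_group G"
    and "rational_representation G s \<rho>"
    and "carrier (rational_invariants s UNIV G \<rho>) = invariant_fractions s G \<rho>"
    and "factorial_domain (regular_invariants s UNIV G \<rho>)"
    and "galois_restriction_property s G \<rho> Y W \<alpha>"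
    and "\<And>v. closedin (zariski s) (orbit_of G \<rho> v) \<Longrightarrow> Y \<inter> orbit_of G \<rho> v \<noteq> {}"
  shows "(\<lambda>f. restrict f Y) \<in> ring_iso (regular_invariants s UNIV G \<rho>)
           (regular_rational_invariants s Y (carrier W) \<alpha>) \<and>
         (faithful_regular_action s Y W \<alpha> \<longrightarrow> chevalley_restriction_property s G \<rho> Y W \<alpha>)"
proof -
  interpret finite_dimensional_vector_space s B by fact
  let ?R = "regular_invariants s UNIV G \<rho>" and ?S = "regular_rational_invariants s Y (carrier W) \<alpha>"
  have Y: "closed_subvariety s Y" and irr: "irreduciblein (zariski s) Y"
    and W: "group W" "finite (carrier W)"
    and iso: "rational_restriction s Y \<in>
       ring_iso (rational_invariants s UNIV G \<rho>) (rational_invariants s Y (carrier W) \<alpha>)"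
    using assms(6) by (auto simp: galois_restriction_property_def closed_subvariety_def)
  have G: "linear_algebraic_group G" using assms(2) by (simp add: reductive_group_def)
  note nz = galois_restriction_nonzero[OF vector_space_axioms assms(4,6)]
  note frac = rational_restriction_fraction[OF vector_space_axioms irr]
  \<comment> \<open>Galois surjectivity and the hypothesis on fractions combine: every invariant
    rational function on \<open>Y\<close> is the restriction of a quotient of invariant
    polynomials.\<close>
  have bij: "rational_restriction s Y ` invariant_fractions s G \<rho> = carrier (rational_invariants s Y (carrier W) \<alpha>)"
    using iso unfolding ring_iso_def bij_betw_def assms(4) by blast
  have poly: "f \<in> poly_functions s" if "f \<in> carrier ?R" for f
    using that by (simp add: carrier_regular_invariants_UNIV)
  have one: "(\<lambda>_. 1) \<in> carrier ?R" by (simp add: carrier_regular_invariants_UNIV poly_functions.const)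
  obtain y0 where y0: "y0 \<in> Y" using irr by (auto simp: irreduciblein_def)
  have S: "restrict h Y \<in> carrier ?S \<longleftrightarrow> germ s Y (restrict h Y) \<in> carrier (rational_invariants s Y (carrier W) \<alpha>)"
    if "h \<in> poly_functions s" for h
    using that by (auto simp: regular_rational_invariants_def coordinate_ring_def)
  have into: "restrict f Y \<in> carrier ?S" if f: "f \<in> carrier ?R" for f
  proof -
    have "germ s UNIV (\<lambda>x. f x / 1) \<in> invariant_fractions s G \<rho>"
      using f one unfolding invariant_fractions_def by fastforce
    then have "germ s Y (\<lambda>x. f x / 1) \<in> carrier (rational_invariants s Y (carrier W) \<alpha>)"
      using bij frac[OF poly[OF f] poly[OF one] y0] by force
    moreover have "germ s Y (restrict f Y) = germ s Y (\<lambda>x. f x / 1)"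
      unfolding germ_eq_iff[OF irr] by (rule generically_everywhere[OF irr]) simp
    ultimately show ?thesis unfolding S[OF poly[OF f]] by simp
  qed
  \<comment> \<open>The difference of two invariants is an invariant, which by \<open>nz\<close>
    vanishes on \<open>Y\<close> only if it is zero.\<close>
  have inj: "inj_on (\<lambda>f. restrict f Y) (carrier ?R)"
  proof (rule inj_onI, rule ccontr)
    fix f g assume fg: "f \<in> carrier ?R" "g \<in> carrier ?R" "restrict f Y = restrict g Y" "f \<noteq> g"
    then obtain x where "f x - g x \<noteq> 0" by (auto simp: fun_eq_iff)
    moreover have "(\<lambda>x. f x - g x) \<in> carrier ?R"
      using fg(1,2) by (simp add: carrier_regular_invariants_UNIV poly_functions_diff)
    ultimately obtain y where "y \<in> Y" "f y - g y \<noteq> 0" using nz by blast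
    then show False using fun_cong[OF fg(3), of y] by simp
  qed
  have surj: "h \<in> (\<lambda>f. restrict f Y) ` carrier ?R" if h: "h \<in> carrier ?S" for h
  proof -
    obtain H where H: "H \<in> poly_functions s" "h = restrict H Y"
      using h by (auto simp: regular_rational_invariants_def coordinate_ring_def)
    have "germ s Y h \<in> rational_restriction s Y ` invariant_fractions s G \<rho>"
      using h S[OF H(1)] bij H(2) by simp
    then obtain p q x where pq: "p \<in> carrier ?R" "q \<in> carrier ?R" "q x \<noteq> 0"
      "germ s Y h = rational_restriction s Y (germ s UNIV (\<lambda>x. p x / q x))"
      unfolding invariant_fractions_def by blast
    \<comment> \<open>So far \<open>q\<close> is nonzero only somewhere on the whole space; a
      nonzero value on \<open>Y\<close> is what makes \<open>p / q\<close> a fraction there.\<close>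
    obtain y1 where y1: "y1 \<in> Y" "q y1 \<noteq> 0" using nz pq(2,3) by blast
    have "germ s Y (\<lambda>y. H y / 1) = germ s Y h"
      unfolding germ_eq_iff[OF irr] by (rule generically_everywhere[OF irr]) (simp add: H(2))
    then have "germ s Y (\<lambda>y. H y / 1) = germ s Y (\<lambda>y. p y / q y)"
      unfolding pq(4) by (simp add: frac[OF poly[OF pq(1)] poly[OF pq(2)] y1])
    then have eq: "p y = H y * q y" if "y \<in> Y" for y
      using germ_fraction_eq_iff[OF irr H(1) poly[OF one] _ poly[OF pq(1)] poly[OF pq(2)]] y0 y1 that
      by fastforce
    obtain r where r: "r \<in> carrier ?R" "\<And>x. p x = r x * q x"
      by (rule invariant_divides[OF assms(1) G assms(3,5) irr assms(7) nz pq(1,2,3) H(1) eq]) auto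
    have "r y = H y" if "y \<in> Y" for y
      by (rule poly_functions_cancel_on[OF irr poly[OF r(1)] H(1) poly[OF pq(2)] _ _ that])
         (use y1 r(2) eq in auto)
    then have "h = restrict r Y" unfolding H(2) by (auto simp: restrict_def fun_eq_iff)
    then show ?thesis using r(1) by blast
  qed
  have "(\<lambda>f. restrict f Y) \<in> ring_hom ?R ?S"
  proof (rule ring_hom_memI)
    fix f g
    show "restrict (f \<otimes>\<^bsub>?R\<^esub> g) Y = restrict f Y \<otimes>\<^bsub>?S\<^esub> restrict g Y"
      by (auto simp: regular_invariants_simps regular_rational_invariants_def coordinate_ring_def fun_eq_iff)
    show "restrict (f \<oplus>\<^bsub>?R\<^esub> g) Y = restrict f Y \<oplus>\<^bsub>?S\<^esub> restrict g Y"
      by (auto simp: regular_invariants_simps regular_rational_invariants_def coordinate_ring_def fun_eq_iff)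
    show "restrict \<one>\<^bsub>?R\<^esub> Y = \<one>\<^bsub>?S\<^esub>"
      by (auto simp: regular_invariants_simps regular_rational_invariants_def coordinate_ring_def fun_eq_iff)
  qed (rule into)
  moreover have "bij_betw (\<lambda>f. restrict f Y) (carrier ?R) (carrier ?S)"
    unfolding bij_betw_def using inj into surj by blast
  ultimately have "(\<lambda>f. restrict f Y) \<in> ring_iso ?R ?S" by (simp add: ring_iso_def)
  then show ?thesis
    using regular_rational_invariants_eq[OF irr, of W \<alpha>] Y W
    unfolding chevalley_restriction_property_def by metis
qed

end
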